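(* Let $G\in\mathcal{Q}$. Then $c(G)=2^{|V(G)|-3}$.
   Context: The family $\mathcal{Q}$ of graphs is defined recursively: the complete graph $K_3$ belongs to $\mathcal{Q}$; and whenever $G_1,G_2\in\mathcal{Q}$, $u_1,v_1$ are two distinct vertices of $G_1$ and $e=u_2v_2$ is an edge of $G_2$, the graph obtained from disjoint copies of $G_1$ and $G_2-e$ by identifying $u_1$ with $u_2$ and $v_1$ with $v_2$ belongs to $\mathcal{Q}$. (All graphs in $\mathcal{Q}$ are rigid.) A complex realisation of a graph $G=(V,E)$ is a map $p:V\to\mathbb{C}^2$; for $P=(x,y)$ put $d(P)=x^2+y^2$. Realisations $(G,p),(G,q)$ are equivalent if $d(p(u)-p(v))=d(q(u)-q(v))$ for all $uv\in E$, and congruent if this holds for all $u,v\in V$. A realisation is generic if the set of all coordinates of the points $p(v)$ is algebraically independent over $\mathbb{Q}$. For a rigid graph $G$ (one whose rigidity matrix at a generic real realisation has rank $2|V|-3$), $c(G)$ is the number of congruence classes in the set of complex realisations equivalent to a given generic complex realisation (finite and independent of the choice). *)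

theory Defs
  imports Complex_Main
begin

text \<open>Graphs are pairs (V, E) with V a vertex set and E a set of two-element
  vertex sets. The family Q: K3 on any three distinct vertices; gluing of
  G1 and G2 - e along two vertices, where the two graphs share exactly
  the two identified vertices u, v and e = uv is an edge of G2.\<close>

inductive Q_graph :: "'a set \<Rightarrow> 'a set set \<Rightarrow> bool" where
  K3: "a \<noteq> b \<Longrightarrow> b \<noteq> c \<Longrightarrow> a \<noteq> c \<Longrightarrow>
       Q_graph {a, b, c} {{a, b}, {b, c}, {a, c}}"
| glue: "Q_graph V1 E1 \<Longrightarrow> Q_graph V2 E2 \<Longrightarrow> V1 \<inter> V2 = {u, v} \<Longrightarrow> u \<noteq> v \<Longrightarrow>
       {u, v} \<in> E2 \<Longrightarrow> Q_graph (V1 \<union> V2) (E1 \<union> (E2 - {{u, v}}))"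

definition sqd :: "('a \<Rightarrow> complex \<times> complex) \<Rightarrow> 'a \<Rightarrow> 'a \<Rightarrow> complex" where
  "sqd p u v = (fst (p u) - fst (p v))\<^sup>2 + (snd (p u) - snd (p v))\<^sup>2"

definition equivalent_real :: "'a set set \<Rightarrow> ('a \<Rightarrow> complex \<times> complex) \<Rightarrow> ('a \<Rightarrow> complex \<times> complex) \<Rightarrow> bool" where
  "equivalent_real E p q \<longleftrightarrow> (\<forall>u v. {u, v} \<in> E \<longrightarrow> sqd p u v = sqd q u v)"

definition congruent_real :: "'a set \<Rightarrow> ('a \<Rightarrow> complex \<times> complex) \<Rightarrow> ('a \<Rightarrow> complex \<times> complex) \<Rightarrow> bool" where
  "congruent_real V p q \<longleftrightarrow> (\<forall>u\<in>V. \<forall>v\<in>V. sqd p u v = sqd q u v)"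

text \<open>Algebraic independence over Q of a finite family x indexed by I:
  no nonzero polynomial with rational coefficients in the variables
  indexed by I vanishes at x. A polynomial is a finitely supported
  coefficient function on exponent vectors supported on I.\<close>

definition alg_indep :: "'i set \<Rightarrow> ('i \<Rightarrow> complex) \<Rightarrow> bool" where
  "alg_indep I x \<longleftrightarrow>
     (\<forall>c :: ('i \<Rightarrow> nat) \<Rightarrow> rat.
        finite {m. c m \<noteq> 0} \<and> (\<forall>m. c m \<noteq> 0 \<longrightarrow> (\<forall>i. i \<notin> I \<longrightarrow> m i = 0)) \<and>
        (\<Sum>m\<in>{m. c m \<noteq> 0}. of_rat (c m) * (\<Prod>i\<in>I. x i ^ m i)) = 0
        \<longrightarrow> (\<forall>m. c m = 0))"

definition generic_real :: "'a set \<Rightarrow> ('a \<Rightarrow> complex \<times> complex) \<Rightarrow> bool" where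
  "generic_real V p \<longleftrightarrow>
     alg_indep (V \<times> (UNIV :: bool set)) (\<lambda>(v, b). if b then fst (p v) else snd (p v))"

definition num_classes :: "'a set \<Rightarrow> 'a set set \<Rightarrow> ('a \<Rightarrow> complex \<times> complex) \<Rightarrow> nat" where
  "num_classes V E p =
     card ({q. equivalent_real E p q} // {(q, q'). congruent_real V q q'})"

end

(*
  In the isotropic coordinates z = x + iy, w = x - iy the squared distance is (z - z')(w - w'), so
  (z, w) |-> (tz, w/t) is an isometry. A graph in Q has 2|V| - 3 edges, and for generic p its edge
  lengths are algebraically independent, since together with three coordinates they generate a field
  over which all coordinates of p are algebraic. Conversely, let q be any realisation with
  independent lengths. If some distance q(u)q(v) were algebraic, or three points of q were
  collinear, all lengths would be algebraic over 2|V| - 4 coordinates, which is impossible.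

  Count realisations with u at the origin and v at z-coordinate 1. A congruence class contains
  exactly two of them, exchanged by the reflection in the line uv, and under gluing at u, v these
  pinned realisations are pairs of pinned realisations of the two parts: the first part determines
  the length of uv, which is transcendental, so the lengths in the second part are again
  independent. Hence 2 c(G) = 2 c(G1) * 2 c(G2).

  Algebraic dependence is handled by derivations of the complex numbers.
*)

theory Submission
  imports Defs "HOL-Computational_Algebra.Polynomial"
begin

section \<open>Extending derivations\<close>

definition derivation :: "(complex \<Rightarrow> complex) \<Rightarrow> bool" where
  "derivation \<delta> \<longleftrightarrow> (\<forall>x y. \<delta> (x + y) = \<delta> x + \<delta> y) \<and> (\<forall>x y. \<delta> (x * y) = x * \<delta> y + y * \<delta> x)"

text \<open>The graph of a derivation defined on a subring, viewed as a subring of the dual numbers.\<close>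

definition dual_ring :: "(complex \<times> complex) set \<Rightarrow> bool" where
  "dual_ring D \<longleftrightarrow> (1, 0) \<in> D \<and>
     (\<forall>r s. (r, s) \<in> D \<longrightarrow> (- r, - s) \<in> D) \<and>
     (\<forall>r s r' s'. (r, s) \<in> D \<longrightarrow> (r', s') \<in> D \<longrightarrow>
        (r + r', s + s') \<in> D \<and> (r * r', r * s' + r' * s) \<in> D) \<and>
     (\<forall>s. (0, s) \<in> D \<longrightarrow> s = 0)"

lemma dual_ring_one: "dual_ring D \<Longrightarrow> (1, 0) \<in> D"
  and dual_ring_minus: "dual_ring D \<Longrightarrow> (r, s) \<in> D \<Longrightarrow> (- r, - s) \<in> D"
  and dual_ring_add: "dual_ring D \<Longrightarrow> (r, s) \<in> D \<Longrightarrow> (r', s') \<in> D \<Longrightarrow> (r + r', s + s') \<in> D"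
  and dual_ring_mult: "dual_ring D \<Longrightarrow> (r, s) \<in> D \<Longrightarrow> (r', s') \<in> D \<Longrightarrow>
    (r * r', r * s' + r' * s) \<in> D"
  and dual_ring_sv: "dual_ring D \<Longrightarrow> (0, s) \<in> D \<Longrightarrow> s = 0"
  unfolding dual_ring_def by blast+

lemma dual_ring_zero: assumes "dual_ring D" shows "(0, 0) \<in> D"
  using dual_ring_add[OF assms dual_ring_one[OF assms] dual_ring_minus[OF assms dual_ring_one[OF assms]]]
  by simp

lemma dual_ring_diff:
  assumes "dual_ring D" "(r, s) \<in> D" "(r', s') \<in> D"
  shows "(r - r', s - s') \<in> D"
  using dual_ring_add[OF assms(1,2) dual_ring_minus[OF assms(1,3)]] by simp

lemma dual_ring_unique:
  assumes "dual_ring D" "(r, s) \<in> D" "(r, s') \<in> D"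
  shows "s = s'"
  using dual_ring_sv[OF assms(1), of "s - s'"] dual_ring_diff[OF assms] by simp

lemma dual_ring_sum:
  assumes "dual_ring D" "finite A" "\<And>k. k \<in> A \<Longrightarrow> (f k, g k) \<in> D"
  shows "(sum f A, sum g A) \<in> D"
  using assms(2,3)
  by (induction A rule: finite_induct) (auto intro: dual_ring_zero dual_ring_add assms(1))

lemma dual_ring_of_nat:
  assumes "dual_ring D" shows "(of_nat n, 0) \<in> D"
proof (induction n)
  case 0 show ?case using dual_ring_zero[OF assms] by simp
next
  case (Suc n)
  show ?case using dual_ring_add[OF assms dual_ring_one[OF assms] Suc] by simp
qed

text \<open>If \<open>D\<close> is the graph of a derivation, \<open>h\<close> is \<open>g\<close>
  with the derivation applied to each coefficient, while the variable itself counts as a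
  constant.\<close>

definition dual_poly :: "(complex \<times> complex) set \<Rightarrow> complex poly \<Rightarrow> complex poly \<Rightarrow> bool" where
  "dual_poly D g h \<longleftrightarrow> (\<forall>k. (coeff g k, coeff h k) \<in> D)"

lemma dual_poly_add:
  assumes "dual_ring D" "dual_poly D g h" "dual_poly D g' h'"
  shows "dual_poly D (g + g') (h + h')"
  using assms by (auto simp: dual_poly_def intro: dual_ring_add)

lemma dual_poly_minus:
  assumes "dual_ring D" "dual_poly D g h"
  shows "dual_poly D (- g) (- h)"
  using assms by (auto simp: dual_poly_def intro: dual_ring_minus)

lemma dual_poly_mult:
  assumes D: "dual_ring D" and "dual_poly D g h" "dual_poly D g' h'"
  shows "dual_poly D (g * g') (g * h' + g' * h)"
  unfolding dual_poly_def
proof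
  fix k
  have "(\<Sum>i\<le>k. coeff g i * coeff g' (k - i),
         \<Sum>i\<le>k. coeff g i * coeff h' (k - i) + coeff g' (k - i) * coeff h i) \<in> D"
    using assms by (intro dual_ring_sum dual_ring_mult) (auto simp: dual_poly_def)
  moreover have "coeff (g' * h) k = (\<Sum>i\<le>k. coeff g' (k - i) * coeff h i)"
    unfolding mult.commute[of g'] coeff_mult by (simp add: mult.commute)
  ultimately show "(coeff (g * g') k, coeff (g * h' + g' * h) k) \<in> D"
    by (simp add: coeff_mult sum.distrib)
qed

lemma dual_poly_monom:
  assumes "dual_ring D" "(r, s) \<in> D"
  shows "dual_poly D (monom r n) (monom s n)"
  using assms by (auto simp: dual_poly_def intro: dual_ring_zero)

lemma dual_poly_pderiv:
  assumes D: "dual_ring D" and "dual_poly D g h"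
  shows "dual_poly D (pderiv g) (pderiv h)"
  unfolding dual_poly_def
proof
  fix k
  have "(of_nat (Suc k) * coeff g (Suc k), of_nat (Suc k) * coeff h (Suc k) + coeff g (Suc k) * 0) \<in> D"
    using assms by (intro dual_ring_mult dual_ring_of_nat) (auto simp: dual_poly_def)
  then show "(coeff (pderiv g) k, coeff (pderiv h) k) \<in> D"
    by (simp add: coeff_pderiv)
qed

text \<open>Sending \<open>a\<close> to \<open>b\<close> forces the value of \<open>g(a)\<close> to
  be \<open>h(a) + g'(a) b\<close>. Two polynomials with the same value at \<open>a\<close> differ
  by one vanishing at \<open>a\<close>, so the assumption on \<open>b\<close> says exactly that this
  value is well defined.\<close>

lemma dual_ring_adjoin:
  assumes D: "dual_ring D"
    and b: "\<And>g h. dual_poly D g h \<Longrightarrow> poly g a = 0 \<Longrightarrow> poly h a + poly (pderiv g) a * b = 0"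
  obtains D' where "dual_ring D'" "D \<subseteq> D'" "(a, b) \<in> D'"
proof -
  define D' where "D' = {(poly g a, poly h a + poly (pderiv g) a * b) | g h. dual_poly D g h}"
  have I: "(poly g a, poly h a + poly (pderiv g) a * b) \<in> D'" if "dual_poly D g h" for g h
    using that D'_def by blast
  have const: "(r, s) \<in> D'" if "(r, s) \<in> D" for r s
    using I[OF dual_poly_monom[OF D that, of 0]] by (simp add: poly_monom pderiv_monom)
  have "dual_ring D'"
    unfolding dual_ring_def
  proof (intro conjI allI impI)
    show "(1, 0) \<in> D'" using const dual_ring_one[OF D] by blast
  next
    fix r s assume "(r, s) \<in> D'"
    then obtain g h where "dual_poly D g h" "r = poly g a" "s = poly h a + poly (pderiv g) a * b"
      by (auto simp: D'_def)
    then show "(- r, - s) \<in> D'"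
      using I[OF dual_poly_minus[OF D, of g h]] by (simp add: pderiv_minus)
  next
    fix r s r' s' assume "(r, s) \<in> D'" "(r', s') \<in> D'"
    then obtain g h g' h' where
      gh: "dual_poly D g h" "r = poly g a" "s = poly h a + poly (pderiv g) a * b"
          "dual_poly D g' h'" "r' = poly g' a" "s' = poly h' a + poly (pderiv g') a * b"
      by (auto simp: D'_def)
    show "(r + r', s + s') \<in> D'"
      using I[OF dual_poly_add[OF D gh(1,4)]] gh by (simp add: pderiv_add algebra_simps)
    show "(r * r', r * s' + r' * s) \<in> D'"
      using I[OF dual_poly_mult[OF D gh(1,4)]] gh by (simp add: pderiv_mult algebra_simps)
  next
    fix s assume "(0, s) \<in> D'"
    then show "s = 0" using b by (auto simp: D'_def)
  qed
  moreover have "(a, b) \<in> D'"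
    using I[OF dual_poly_monom[OF D dual_ring_one[OF D], of 1]]
    by (simp add: poly_monom pderiv_monom)
  moreover have "D \<subseteq> D'" using const by auto
  ultimately show thesis using that by blast
qed

text \<open>For algebraic \<open>a\<close> the value of the extended derivation at \<open>a\<close> is dictated by an annihilating
  polynomial of least degree; pseudo-division carries the compatibility over to all others.\<close>

lemma dual_ring_value_exists:
  assumes D: "dual_ring D"
  shows "\<exists>b. \<forall>g h. dual_poly D g h \<longrightarrow> poly g a = 0 \<longrightarrow> poly h a + poly (pderiv g) a * b = 0"
proof (cases "\<exists>g h. dual_poly D g h \<and> g \<noteq> 0 \<and> poly g a = 0")
  case False
  have "poly h a + poly (pderiv g) a * 0 = 0" if "dual_poly D g h" "poly g a = 0" for g h
  proof -
    have "g = 0" using False that by blast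
    then have "coeff h k = 0" for k using that(1) dual_ring_sv[OF D] by (auto simp: dual_poly_def)
    then have "h = 0" by (simp add: poly_eq_iff)
    then show ?thesis by simp
  qed
  then show ?thesis by blast
next
  case True
  define P where "P n \<longleftrightarrow> (\<exists>g h. dual_poly D g h \<and> g \<noteq> 0 \<and> poly g a = 0 \<and> degree g = n)" for n
  have "\<exists>n. P n" using True by (auto simp: P_def)
  then obtain n where n: "P n" and least: "\<And>m. m < n \<Longrightarrow> \<not> P m"
    using exists_least_iff[of P] by blast
  obtain f f' where f: "dual_poly D f f'" "f \<noteq> 0" "poly f a = 0" "degree f = n"
    using n by (auto simp: P_def)
  have small: "g = 0" if "dual_poly D g h" "poly g a = 0" "degree g < n" for g h
    using least[of "degree g"] that by (auto simp: P_def)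
  have "n \<noteq> 0"
  proof
    assume "n = 0"
    then obtain c where "f = [:c:]" using f(4) by (metis degree_eq_zeroE)
    then show False using f by simp
  qed
  then have pf: "pderiv f \<noteq> 0" using f(4) by (simp add: pderiv_eq_0_iff)
  have "degree (pderiv f) < n" using f(4) \<open>n \<noteq> 0\<close> by (simp add: degree_pderiv)
  then have pfa: "poly (pderiv f) a \<noteq> 0"
    using small[OF dual_poly_pderiv[OF D f(1)]] pf by blast
  \<comment> \<open>Obtained by differentiating \<open>f(a) = 0\<close>. The denominator is nonzero
    because \<open>pderiv f\<close> is a nonzero polynomial of smaller degree, so by minimality it
    cannot vanish at \<open>a\<close>.\<close>
  define b where "b = - poly f' a / poly (pderiv f) a"
  have fb: "poly f' a + poly (pderiv f) a * b = 0" using pfa by (simp add: b_def)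
  have "poly h a + poly (pderiv g) a * b = 0" if "dual_poly D g h" "poly g a = 0" for g h
    using that
  proof (induction "degree g" arbitrary: g h rule: less_induct)
    case less
    show ?case
    proof (cases "degree g < n")
      case True
      then have "g = 0" using small less.prems by blast
      then have "coeff h k = 0" for k
        using less.prems(1) dual_ring_sv[OF D] by (auto simp: dual_poly_def)
      then have "h = 0" by (simp add: poly_eq_iff)
      then show ?thesis using \<open>g = 0\<close> by simp
    next
      case False
      \<comment> \<open>One step of pseudo-division: \<open>D\<close> is only a ring, so
        \<open>g\<close> is multiplied by the leading coefficient of \<open>f\<close> before a
        multiple of \<open>f\<close> cancels its top term. The primed polynomials are the
        coefficientwise derivatives.\<close>
      define c where "c = monom (coeff f n) 0"
      define c' where "c' = monom (coeff f' n) 0"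
      define e where "e = monom (coeff g (degree g)) (degree g - n)"
      define e' where "e' = monom (coeff h (degree g)) (degree g - n)"
      have cc: "dual_poly D c c'" and ee: "dual_poly D e e'"
        using f(1) less.prems(1) dual_poly_monom[OF D]
        by (auto simp: c_def c'_def e_def e'_def dual_poly_def)
      define g1 where "g1 = c * g - e * f"
      define h1 where "h1 = (c * h + g * c') - (e * f' + f * e')"
      have d1: "dual_poly D g1 h1"
        using dual_poly_add[OF D dual_poly_mult[OF D cc less.prems(1)]
            dual_poly_minus[OF D dual_poly_mult[OF D ee f(1)]]]
        by (simp only: g1_def h1_def diff_conv_add_uminus)
      have z1: "poly g1 a = 0" using f(3) less.prems(2) by (simp add: g1_def)
      have deg: "degree g1 < degree g"
      proof (rule degree_lessI)
        show "g1 \<noteq> 0 \<or> 0 < degree g" using False \<open>n \<noteq> 0\<close> by auto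
        show "\<forall>k\<ge>degree g. coeff g1 k = 0"
        proof (intro allI impI)
          fix k assume k: "degree g \<le> k"
          have "coeff (c * g) k = coeff f n * coeff g k"
            by (simp add: c_def coeff_monom_mult)
          moreover have "coeff (e * f) k = coeff g (degree g) * coeff f (k - (degree g - n))"
            using k by (simp add: e_def coeff_monom_mult)
          moreover have "coeff f (k - (degree g - n)) = 0" if "k \<noteq> degree g"
            using that k False f(4) by (intro coeff_eq_0) auto
          moreover have "coeff g k = 0" if "k \<noteq> degree g"
            using that k by (intro coeff_eq_0) auto
          ultimately show "coeff g1 k = 0"
            using False by (cases "k = degree g") (auto simp: g1_def)
        qed
      qed
      have "poly h1 a + poly (pderiv g1) a * b = 0" using less.hyps[OF deg d1 z1] .
      \<comment> \<open>In the product rule every term containing \<open>g(a)\<close> or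
        \<open>f(a)\<close> vanishes. The bracket for \<open>f\<close> is zero by the choice of
        \<open>b\<close>, and \<open>c(a)\<close> is the nonzero leading coefficient of
        \<open>f\<close>, so the bracket for \<open>g\<close> is zero.\<close>
      then have "poly c a * (poly h a + poly (pderiv g) a * b)
          - poly e a * (poly f' a + poly (pderiv f) a * b) = 0"
        using f(3) less.prems(2)
        by (simp add: g1_def h1_def pderiv_diff pderiv_mult algebra_simps)
      moreover have "poly c a \<noteq> 0" using f by (auto simp: c_def poly_monom)
      ultimately show ?thesis using fb by simp
    qed
  qed
  then show ?thesis by blast
qed

text \<open>By Zorn there is a maximal dual ring above \<open>D0\<close>. An admissible value can be
  adjoined at any \<open>a\<close>, so maximality makes its domain all of the complex numbers, and
  single-valuedness turns it into a function.\<close>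

lemma derivation_extends:
  assumes D0: "dual_ring D0"
  obtains \<delta> where "derivation \<delta>" "\<And>r s. (r, s) \<in> D0 \<Longrightarrow> \<delta> r = s"
proof -
  define A where "A = {D. dual_ring D \<and> D0 \<subseteq> D}"
  have "\<exists>M\<in>A. \<forall>X\<in>A. M \<subseteq> X \<longrightarrow> X = M"
  proof (rule subset_Zorn_nonempty)
    show "A \<noteq> {}" using D0 by (auto simp: A_def)
    fix C assume C: "C \<noteq> {}" "subset.chain A C"
    have sub: "\<And>X. X \<in> C \<Longrightarrow> dual_ring X \<and> D0 \<subseteq> X"
      using C(2) by (auto simp: A_def subset.chain_def)
    have tot: "\<And>X Y. X \<in> C \<Longrightarrow> Y \<in> C \<Longrightarrow> X \<subseteq> Y \<or> Y \<subseteq> X"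
      using C(2) by (auto simp: subset.chain_def)
    have "dual_ring (\<Union>C)"
      unfolding dual_ring_def
    proof (intro conjI allI impI)
      show "(1, 0) \<in> \<Union>C" using C(1) sub dual_ring_one by blast
    next
      fix r s assume "(r, s) \<in> \<Union>C"
      then show "(- r, - s) \<in> \<Union>C" using sub dual_ring_minus by blast
    next
      fix r s r' s' assume "(r, s) \<in> \<Union>C" "(r', s') \<in> \<Union>C"
      then obtain X where "X \<in> C" "(r, s) \<in> X" "(r', s') \<in> X"
        using tot by blast
      then show "(r + r', s + s') \<in> \<Union>C" "(r * r', r * s' + r' * s) \<in> \<Union>C"
        using sub dual_ring_add dual_ring_mult by blast+
    next
      fix s assume "(0, s) \<in> \<Union>C"
      then show "s = 0" using sub dual_ring_sv by blast
    qed
    then show "\<Union>C \<in> A" using C(1) sub by (auto simp: A_def)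
  qed
  then obtain M where M: "dual_ring M" "D0 \<subseteq> M"
    and max: "\<And>X. dual_ring X \<Longrightarrow> M \<subseteq> X \<Longrightarrow> X = M"
    by (auto simp: A_def)
  have total: "\<exists>b. (a, b) \<in> M" for a
  proof -
    obtain b where "\<And>g h. dual_poly M g h \<Longrightarrow> poly g a = 0 \<Longrightarrow> poly h a + poly (pderiv g) a * b = 0"
      using dual_ring_value_exists[OF M(1), of a] by blast
    then obtain D' where "dual_ring D'" "M \<subseteq> D'" "(a, b) \<in> D'"
      using dual_ring_adjoin[OF M(1)] by metis
    then show ?thesis using max by blast
  qed
  define \<delta> where "\<delta> a = (SOME b. (a, b) \<in> M)" for a
  have \<delta>: "(a, \<delta> a) \<in> M" for a using someI_ex[OF total[of a]] by (simp add: \<delta>_def)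
  have val: "\<delta> a = b" if "(a, b) \<in> M" for a b using dual_ring_unique[OF M(1) \<delta> that] .
  have "derivation \<delta>"
    unfolding derivation_def
    using val dual_ring_add[OF M(1) \<delta> \<delta>] dual_ring_mult[OF M(1) \<delta> \<delta>] by blast
  then show thesis using that val M(2) by blast
qed

section \<open>The ring generated by a family over the rationals, and partial derivatives for
  algebraically independent families\<close>

inductive_set monomial_span :: "'i set \<Rightarrow> ('i \<Rightarrow> complex) \<Rightarrow> complex set" for J x where
  zero: "0 \<in> monomial_span J x"
| add: "r \<in> monomial_span J x \<Longrightarrow> (\<forall>i. i \<notin> J \<longrightarrow> m i = 0) \<Longrightarrow>
    r + of_rat c * (\<Prod>i\<in>J. x i ^ m i) \<in> monomial_span J x"

lemma monomial_span_add:
  assumes "r \<in> monomial_span J x" "s \<in> monomial_span J x"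
  shows "r + s \<in> monomial_span J x"
  using assms(2)
proof induction
  case zero then show ?case using assms(1) by simp
next
  case (add s m c)
  then show ?case using monomial_span.add[OF add.IH, of m c] by (simp add: add.assoc)
qed

lemma monomial_span_mult_monomial:
  assumes "r \<in> monomial_span J x" "\<forall>i. i \<notin> J \<longrightarrow> m i = 0"
  shows "r * (of_rat c * (\<Prod>i\<in>J. x i ^ m i)) \<in> monomial_span J x"
  using assms(1)
proof induction
  case zero then show ?case using monomial_span.zero by simp
next
  case (add r m' c')
  have "r * (of_rat c * (\<Prod>i\<in>J. x i ^ m i)) + of_rat (c' * c) * (\<Prod>i\<in>J. x i ^ (m' i + m i))
      \<in> monomial_span J x"
    using add assms(2) by (intro monomial_span.add) auto
  then show ?case by (simp add: power_add prod.distrib of_rat_mult algebra_simps)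
qed

lemma monomial_span_mult:
  assumes "r \<in> monomial_span J x" "s \<in> monomial_span J x"
  shows "r * s \<in> monomial_span J x"
  using assms(2)
proof induction
  case zero then show ?case using monomial_span.zero by simp
next
  case (add s m c)
  then show ?case
    using monomial_span_add[OF add.IH monomial_span_mult_monomial[OF assms(1) add.hyps(2)]]
    by (simp add: distrib_left)
qed

lemma monomial_span_one: "1 \<in> monomial_span J x"
  using monomial_span.add[OF monomial_span.zero, where J = J and x = x and m = "\<lambda>_. 0" and c = 1] by simp

lemma monomial_span_minus: "r \<in> monomial_span J x \<Longrightarrow> - r \<in> monomial_span J x"
  using monomial_span_mult_monomial[of r J x "\<lambda>_. 0" "-1"] by simp

lemma monomial_span_generator:
  assumes "finite J" "j \<in> J"
  shows "x j \<in> monomial_span J x"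
proof -
  have "(\<Prod>i\<in>J. x i ^ (if i = j then 1 else 0)) = (\<Prod>i\<in>J. if i = j then x i else 1)"
    by (intro prod.cong) auto
  then show ?thesis
    using monomial_span.add[OF monomial_span.zero, where J = J and x = x
        and m = "\<lambda>i. if i = j then 1 else 0" and c = 1] assms
    by (simp add: prod.delta)
qed

lemma monomial_span_coefficients:
  assumes "r \<in> monomial_span J x"
  shows "\<exists>c :: ('i \<Rightarrow> nat) \<Rightarrow> rat. finite {m. c m \<noteq> 0} \<and>
    (\<forall>m. c m \<noteq> 0 \<longrightarrow> (\<forall>i. i \<notin> J \<longrightarrow> m i = 0)) \<and>
    r = (\<Sum>m\<in>{m. c m \<noteq> 0}. of_rat (c m) * (\<Prod>i\<in>J. x i ^ m i))"
  using assms
proof induction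
  case zero
  show ?case by (rule exI[of _ "\<lambda>_. 0"]) simp
next
  case (add r m0 k)
  then obtain c :: "('i \<Rightarrow> nat) \<Rightarrow> rat" where c: "finite {m. c m \<noteq> 0}"
    "\<forall>m. c m \<noteq> 0 \<longrightarrow> (\<forall>i. i \<notin> J \<longrightarrow> m i = 0)"
    "r = (\<Sum>m\<in>{m. c m \<noteq> 0}. of_rat (c m) * (\<Prod>i\<in>J. x i ^ m i))" by blast
  define c' where "c' = c(m0 := c m0 + k)"
  define F where "F = insert m0 {m. c m \<noteq> 0}"
  have F: "finite F" "m0 \<in> F" using c(1) by (auto simp: F_def)
  have sub: "{m. c' m \<noteq> 0} \<subseteq> F" by (auto simp: c'_def F_def)
  have "(\<Sum>m\<in>{m. c' m \<noteq> 0}. of_rat (c' m) * (\<Prod>i\<in>J. x i ^ m i))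
      = (\<Sum>m\<in>F. of_rat (c' m) * (\<Prod>i\<in>J. x i ^ m i))"
    using F sub by (intro sum.mono_neutral_left) auto
  also have "\<dots> = (\<Sum>m\<in>F. of_rat (c m) * (\<Prod>i\<in>J. x i ^ m i)
      + (if m = m0 then of_rat k * (\<Prod>i\<in>J. x i ^ m i) else 0))"
    by (intro sum.cong) (auto simp: c'_def of_rat_add algebra_simps)
  also have "\<dots> = (\<Sum>m\<in>F. of_rat (c m) * (\<Prod>i\<in>J. x i ^ m i))
      + of_rat k * (\<Prod>i\<in>J. x i ^ m0 i)"
    using F by (simp add: sum.distrib sum.delta)
  also have "(\<Sum>m\<in>F. of_rat (c m) * (\<Prod>i\<in>J. x i ^ m i)) = r"
    unfolding c(3) using F by (intro sum.mono_neutral_right) (auto simp: F_def)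
  finally show ?case
    using c(2) add.hyps(2) finite_subset[OF sub F(1)]
    by (intro exI[of _ c']) (auto simp: c'_def split: if_splits)
qed

text \<open>Expanding each coefficient of \<open>g\<close> into monomials in the other variables
  turns \<open>poly g (x i0) = 0\<close> into one rational relation among all \<open>x i\<close>, so
  every coefficient in it is zero.\<close>

lemma alg_indep_transcendental:
  fixes x :: "'i \<Rightarrow> complex"
  assumes x: "alg_indep I x" and I: "finite I" "i0 \<in> I"
    and g: "\<And>k. coeff g k \<in> monomial_span (I - {i0}) x" and root: "poly g (x i0) = 0"
  shows "g = 0"
proof -
  define J where "J = I - {i0}"
  have "\<forall>k. \<exists>c :: ('i \<Rightarrow> nat) \<Rightarrow> rat. finite {m. c m \<noteq> 0} \<and>
    (\<forall>m. c m \<noteq> 0 \<longrightarrow> (\<forall>i. i \<notin> J \<longrightarrow> m i = 0)) \<and>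
    coeff g k = (\<Sum>m\<in>{m. c m \<noteq> 0}. of_rat (c m) * (\<Prod>i\<in>J. x i ^ m i))"
    using monomial_span_coefficients[OF g] by (auto simp: J_def)
  then obtain C :: "nat \<Rightarrow> ('i \<Rightarrow> nat) \<Rightarrow> rat" where C: "\<And>k. finite {m. C k m \<noteq> 0}"
    "\<And>k m i. C k m \<noteq> 0 \<Longrightarrow> i \<notin> J \<Longrightarrow> m i = 0"
    "\<And>k. coeff g k = (\<Sum>m\<in>{m. C k m \<noteq> 0}. of_rat (C k m) * (\<Prod>i\<in>J. x i ^ m i))"
    unfolding choice_iff by blast
  have Ci: "m i0 = 0" if "C k m \<noteq> 0" for k m using C(2)[OF that, of i0] by (simp add: J_def)
  \<comment> \<open>The exponent of \<open>i0\<close> is read as the power in \<open>g\<close>, the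
    remaining exponents as a monomial inside that coefficient. \<open>\<phi>\<close> is the inverse
    encoding, and the bound \<open>degree g\<close> keeps the support finite.\<close>
  define c where "c m = (if m i0 \<le> degree g then C (m i0) (m(i0 := 0)) else 0)" for m
  define F where "F = (SIGMA k:{..degree g}. {m. C k m \<noteq> 0})"
  define \<phi> where "\<phi> = (\<lambda>(k, m). m(i0 := k :: nat))"
  have finF: "finite F" using C(1) by (auto simp: F_def)
  have c\<phi>: "c (m(i0 := k)) = C k m" if "(k, m) \<in> F" for k m
  proof -
    have "m(i0 := 0) = m" using Ci[of k m] that by (auto simp: F_def fun_eq_iff)
    then show ?thesis using that by (auto simp: c_def F_def)
  qed
  have supp: "{m. c m \<noteq> 0} = \<phi> ` F"
  proof
    show "{m. c m \<noteq> 0} \<subseteq> \<phi> ` F"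
    proof
      fix m assume "m \<in> {m. c m \<noteq> 0}"
      then have "(m i0, m(i0 := 0)) \<in> F" by (auto simp: c_def F_def split: if_splits)
      moreover have "\<phi> (m i0, m(i0 := 0)) = m" by (auto simp: \<phi>_def)
      ultimately show "m \<in> \<phi> ` F" by (metis imageI)
    qed
    show "\<phi> ` F \<subseteq> {m. c m \<noteq> 0}" using c\<phi> by (auto simp: \<phi>_def F_def)
  qed
  have inj: "inj_on \<phi> F"
  proof (rule inj_onI)
    fix s t assume st: "s \<in> F" "t \<in> F" "\<phi> s = \<phi> t"
    obtain k m l n where kl: "s = (k, m)" "t = (l, n)" by (cases s, cases t) auto
    have e: "m(i0 := k) = n(i0 := l)" using st(3) kl by (simp add: \<phi>_def)
    then have "k = l" by (metis fun_upd_same)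
    moreover have "m i0 = 0" "n i0 = 0" using Ci st kl by (auto simp: F_def)
    then have "m = n" using e by (metis fun_upd_triv fun_upd_upd)
    ultimately show "s = t" using kl by simp
  qed
  have prod: "(\<Prod>i\<in>I. x i ^ (m(i0 := k)) i) = x i0 ^ k * (\<Prod>i\<in>J. x i ^ m i)" for m k
  proof -
    have "(\<Prod>i\<in>J. x i ^ (m(i0 := k)) i) = (\<Prod>i\<in>J. x i ^ m i)"
      by (intro prod.cong) (auto simp: J_def)
    then show ?thesis using prod.remove[OF I, of "\<lambda>i. x i ^ (m(i0 := k)) i"] by (simp add: J_def)
  qed
  have "(\<Sum>m\<in>{m. c m \<noteq> 0}. of_rat (c m) * (\<Prod>i\<in>I. x i ^ m i))
      = (\<Sum>(k, m)\<in>F. of_rat (C k m) * (x i0 ^ k * (\<Prod>i\<in>J. x i ^ m i)))"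
    unfolding supp sum.reindex[OF inj]
    by (intro sum.cong) (auto simp: \<phi>_def c\<phi> prod simp del: fun_upd_apply)
  also have "\<dots> = (\<Sum>k\<le>degree g. \<Sum>m\<in>{m. C k m \<noteq> 0}. of_rat (C k m) * (x i0 ^ k * (\<Prod>i\<in>J. x i ^ m i)))"
    unfolding F_def by (subst sum.Sigma) (auto simp: C(1))
  also have "\<dots> = (\<Sum>k\<le>degree g. coeff g k * x i0 ^ k)"
    unfolding C(3) by (intro sum.cong) (auto simp: sum_distrib_left algebra_simps)
  also have "\<dots> = 0" using root by (simp add: poly_altdef)
  finally have "(\<Sum>m\<in>{m. c m \<noteq> 0}. of_rat (c m) * (\<Prod>i\<in>I. x i ^ m i)) = 0" .
  moreover have "finite {m. c m \<noteq> 0}" using finF by (simp add: supp)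
  moreover have "\<forall>m. c m \<noteq> 0 \<longrightarrow> (\<forall>i. i \<notin> I \<longrightarrow> m i = 0)"
  proof (intro allI impI)
    fix m i assume m: "c m \<noteq> 0" "i \<notin> I"
    then have "i \<noteq> i0" "i \<notin> J" using I by (auto simp: J_def)
    moreover have "C (m i0) (m(i0 := 0)) \<noteq> 0" using m by (auto simp: c_def split: if_splits)
    ultimately show "m i = 0" using C(2) by (metis fun_upd_other)
  qed
  ultimately have c0: "c m = 0" for m using x unfolding alg_indep_def by blast
  have "C k m = 0" if "k \<le> degree g" for k m
    using c\<phi>[of k m] that c0 by (auto simp: F_def)
  then have "coeff g k = 0" for k
    using C(3)[of k] by (cases "k \<le> degree g") (auto simp: coeff_eq_0)
  then show "g = 0" by (simp add: poly_eq_iff)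
qed

text \<open>The partial derivative with respect to \<open>x i0\<close>: start from the zero
  derivation on the ring generated by the other variables. Since \<open>x i0\<close> is
  transcendental over it, the value 1 there meets no constraint.\<close>

lemma alg_indep_derivation:
  assumes x: "alg_indep I x" and I: "finite I" "i0 \<in> I"
  obtains \<delta> where "derivation \<delta>" "\<delta> (x i0) = 1" "\<And>j. j \<in> I \<Longrightarrow> j \<noteq> i0 \<Longrightarrow> \<delta> (x j) = 0"
proof -
  define R where "R = monomial_span (I - {i0}) x"
  define D0 where "D0 = R \<times> {0 :: complex}"
  have D0: "dual_ring D0"
    by (auto simp: dual_ring_def D0_def R_def monomial_span_one monomial_span_minus
        monomial_span_add monomial_span_mult)
  have "poly h (x i0) + poly (pderiv g) (x i0) * 1 = 0"
    if gh: "dual_poly D0 g h" "poly g (x i0) = 0" for g h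
  proof -
    have "g = 0"
      using gh by (intro alg_indep_transcendental[OF x I]) (auto simp: dual_poly_def D0_def R_def)
    moreover have "h = 0" using gh by (auto simp: poly_eq_iff dual_poly_def D0_def)
    ultimately show ?thesis by simp
  qed
  then obtain D' where D': "dual_ring D'" "D0 \<subseteq> D'" "(x i0, 1) \<in> D'"
    using dual_ring_adjoin[OF D0] by metis
  obtain \<delta> where \<delta>: "derivation \<delta>" "\<And>r s. (r, s) \<in> D' \<Longrightarrow> \<delta> r = s"
    using derivation_extends[OF D'(1)] by metis
  have "\<delta> (x j) = 0" if "j \<in> I" "j \<noteq> i0" for j
  proof -
    have "x j \<in> R" using that I by (auto simp: R_def intro: monomial_span_generator)
    then show ?thesis using D'(2) \<delta>(2) by (auto simp: D0_def)
  qed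
  then show thesis using that[of \<delta>] \<delta> D'(3) by blast
qed

section \<open>Closure and independence via derivations\<close>

lemma derivation_add: "derivation \<delta> \<Longrightarrow> \<delta> (x + y) = \<delta> x + \<delta> y"
  and derivation_mult: "derivation \<delta> \<Longrightarrow> \<delta> (x * y) = x * \<delta> y + y * \<delta> x"
  by (auto simp: derivation_def)

lemma derivation_0: assumes "derivation \<delta>" shows "\<delta> 0 = 0"
  using derivation_add[OF assms, of 0 0] by simp

lemma derivation_1: assumes "derivation \<delta>" shows "\<delta> 1 = 0"
  using derivation_mult[OF assms, of 1 1] by simp

lemma derivation_minus: assumes "derivation \<delta>" shows "\<delta> (- x) = - \<delta> x"
  using derivation_add[OF assms, of x "- x"] derivation_0[OF assms]
  by (simp add: minus_unique)

lemma derivation_diff: assumes "derivation \<delta>" shows "\<delta> (x - y) = \<delta> x - \<delta> y"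
  using derivation_add[OF assms, of x "- y"] derivation_minus[OF assms] by simp

lemma derivation_zero: "derivation (\<lambda>_. 0)"
  by (simp add: derivation_def)

lemma derivation_combination:
  "derivation \<delta> \<Longrightarrow> derivation \<epsilon> \<Longrightarrow> derivation (\<lambda>x. a * \<delta> x + b * \<epsilon> x)"
  by (simp add: derivation_def algebra_simps)

lemma derivation_sum:
  assumes "finite A" "\<And>i. i \<in> A \<Longrightarrow> derivation (\<delta> i)"
  shows "derivation (\<lambda>x. \<Sum>i\<in>A. c i * \<delta> i x)"
  using assms
proof (induction A rule: finite_induct)
  case empty then show ?case by (simp add: derivation_zero)
next
  case (insert i A)
  then show ?case
    using derivation_combination[of "\<delta> i" "\<lambda>x. \<Sum>i\<in>A. c i * \<delta> i x" "c i" 1] by simp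
qed

text \<open>Since derivations extend along algebraic extensions in characteristic zero, the differential
  closure is the algebraic closure of the field generated by \<open>S\<close>. Defined in this way it is visibly an
  algebraically closed field, and the exchange property becomes linear algebra in the space of
  derivations.\<close>

definition diff_closure :: "complex set \<Rightarrow> complex set" where
  "diff_closure S = {x. \<forall>\<delta>. derivation \<delta> \<longrightarrow> (\<forall>s\<in>S. \<delta> s = 0) \<longrightarrow> \<delta> x = 0}"

lemma diff_closureI:
  "(\<And>\<delta>. derivation \<delta> \<Longrightarrow> (\<And>s. s \<in> S \<Longrightarrow> \<delta> s = 0) \<Longrightarrow> \<delta> x = 0) \<Longrightarrow> x \<in> diff_closure S"
  by (auto simp: diff_closure_def)

lemma diff_closureD:
  "x \<in> diff_closure S \<Longrightarrow> derivation \<delta> \<Longrightarrow> (\<And>s. s \<in> S \<Longrightarrow> \<delta> s = 0) \<Longrightarrow> \<delta> x = 0"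
  by (auto simp: diff_closure_def)

lemma diff_closure_incl: "x \<in> S \<Longrightarrow> x \<in> diff_closure S"
  unfolding diff_closure_def by blast

lemma diff_closure_trans:
  assumes "S \<subseteq> diff_closure T" "x \<in> diff_closure S"
  shows "x \<in> diff_closure T"
proof (rule diff_closureI)
  fix \<delta> assume d: "derivation \<delta>" "\<And>s. s \<in> T \<Longrightarrow> \<delta> s = 0"
  have "\<delta> s = 0" if "s \<in> S" for s using diff_closureD[OF subsetD[OF assms(1) that] d] .
  then show "\<delta> x = 0" by (rule diff_closureD[OF assms(2) d(1)])
qed

lemma diff_closure_mono: "S \<subseteq> T \<Longrightarrow> x \<in> diff_closure S \<Longrightarrow> x \<in> diff_closure T"
  by (rule diff_closure_trans) (auto intro: diff_closure_incl)

lemma diff_closure_0: "0 \<in> diff_closure S"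
  and diff_closure_1: "1 \<in> diff_closure S"
  using derivation_0 derivation_1 unfolding diff_closure_def by blast+

lemma diff_closure_add: "x + y \<in> diff_closure S"
  and diff_closure_diff: "x - y \<in> diff_closure S"
  and diff_closure_mult: "x * y \<in> diff_closure S"
  if xy: "x \<in> diff_closure S" "y \<in> diff_closure S"
proof -
  have "\<delta> (x + y) = 0 \<and> \<delta> (x - y) = 0 \<and> \<delta> (x * y) = 0"
    if d: "derivation \<delta>" "\<And>s. s \<in> S \<Longrightarrow> \<delta> s = 0" for \<delta>
    using diff_closureD[OF xy(1) d] diff_closureD[OF xy(2) d]
    by (simp add: derivation_add[OF d(1)] derivation_diff[OF d(1)] derivation_mult[OF d(1)])
  then show "x + y \<in> diff_closure S" "x - y \<in> diff_closure S" "x * y \<in> diff_closure S"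
    by (auto simp: diff_closure_def)
qed

lemma diff_closure_cancel:
  assumes "x \<in> diff_closure S" "x \<noteq> 0" "x * y \<in> diff_closure S"
  shows "y \<in> diff_closure S"
proof (rule diff_closureI)
  fix \<delta> assume d: "derivation \<delta>" "\<And>s. s \<in> S \<Longrightarrow> \<delta> s = 0"
  show "\<delta> y = 0"
    using diff_closureD[OF assms(1) d] diff_closureD[OF assms(3) d] assms(2)
    by (simp add: derivation_mult[OF d(1)])
qed

lemma diff_closure_2: "2 \<in> diff_closure S"
  using diff_closure_add[OF diff_closure_1 diff_closure_1] by simp

lemma diff_closure_divide:
  assumes "x \<in> diff_closure S" "y \<in> diff_closure S"
  shows "x / y \<in> diff_closure S"
proof (cases "y = 0")
  case False
  then show ?thesis using assms by - (rule diff_closure_cancel[of y S], auto)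
qed (simp add: diff_closure_0)

text \<open>Differentiating the equation gives \<open>(2 * x + a) * \<delta> x = 0\<close>. Either
  the first factor is nonzero and \<open>\<delta> x = 0\<close>, or \<open>x\<close> is the double
  root \<open>- a / 2\<close>.\<close>

lemma diff_closure_quadratic:
  assumes "a \<in> diff_closure S" "b \<in> diff_closure S" "x * x + a * x + b = 0"
  shows "x \<in> diff_closure S"
proof (cases "2 * x + a = 0")
  case True
  then have "2 * x = 0 - a" by (simp add: eq_neg_iff_add_eq_0)
  then show ?thesis
    using diff_closure_diff[OF diff_closure_0 assms(1)]
    by - (rule diff_closure_cancel[OF diff_closure_2], auto)
next
  case False
  show ?thesis
  proof (rule diff_closureI)
    fix \<delta> assume d: "derivation \<delta>" "\<And>s. s \<in> S \<Longrightarrow> \<delta> s = 0"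
    have "\<delta> (x * x + a * x + b) = 0" using assms(3) derivation_0[OF d(1)] by simp
    then have "(2 * x + a) * \<delta> x = 0"
      using diff_closureD[OF assms(1) d] diff_closureD[OF assms(2) d]
      by (simp add: derivation_add[OF d(1)] derivation_mult[OF d(1)] algebra_simps)
    then show "\<delta> x = 0" using False by simp
  qed
qed

lemma diff_closure_ii: "\<i> \<in> diff_closure S"
  by (rule diff_closure_quadratic[of 0 _ 1]) (simp_all add: diff_closure_0 diff_closure_1)

lemma diff_closure_exchange:
  assumes y: "y \<in> diff_closure (insert x S)" "y \<notin> diff_closure S"
  shows "x \<in> diff_closure (insert y S)"
proof (rule diff_closureI)
  fix \<epsilon> assume e: "derivation \<epsilon>" "\<And>s. s \<in> insert y S \<Longrightarrow> \<epsilon> s = 0"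
  obtain \<delta> where d: "derivation \<delta>" "\<And>s. s \<in> S \<Longrightarrow> \<delta> s = 0" "\<delta> y \<noteq> 0"
    using y(2) by (auto simp: diff_closure_def)
  \<comment> \<open>The combination \<open>\<delta> x * \<epsilon> - \<epsilon> x * \<delta>\<close>
    kills \<open>S\<close> and also \<open>x\<close>, hence it kills \<open>y\<close>.\<close>
  have "\<delta> x * \<epsilon> y + (- \<epsilon> x) * \<delta> y = 0"
    using derivation_combination[OF e(1) d(1), of "\<delta> x" "- \<epsilon> x"] e d
    by (intro diff_closureD[OF y(1), of "\<lambda>z. \<delta> x * \<epsilon> z + (- \<epsilon> x) * \<delta> z"]) auto
  then show "\<epsilon> x = 0" using e(2)[of y] d(3) by simp
qed

text \<open>Independence in dual form: derivations can be prescribed arbitrarily on the family.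
  Being indexed, it also makes \<open>x\<close> injective on \<open>I\<close>.\<close>

definition diff_indep :: "'i set \<Rightarrow> ('i \<Rightarrow> complex) \<Rightarrow> bool" where
  "diff_indep I x \<longleftrightarrow> (\<forall>v. \<exists>\<delta>. derivation \<delta> \<and> (\<forall>i\<in>I. \<delta> (x i) = v i))"

lemma diff_indepE:
  assumes "diff_indep I x"
  obtains \<delta> where "derivation \<delta>" "\<And>i. i \<in> I \<Longrightarrow> \<delta> (x i) = v i"
  using assms unfolding diff_indep_def by blast

lemma diff_indep_subset: "diff_indep I x \<Longrightarrow> J \<subseteq> I \<Longrightarrow> diff_indep J x"
  unfolding diff_indep_def by blast

lemma diff_indep_if_dual_derivations:
  assumes I: "finite I"
    and dual: "\<And>i. i \<in> I \<Longrightarrow> \<exists>\<delta>. derivation \<delta> \<and> \<delta> (x i) \<noteq> 0 \<and> (\<forall>j\<in>I. j \<noteq> i \<longrightarrow> \<delta> (x j) = 0)"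
  shows "diff_indep I x"
  unfolding diff_indep_def
proof
  fix v
  from dual obtain \<delta> where d: "\<And>i. i \<in> I \<Longrightarrow> derivation (\<delta> i)" "\<And>i. i \<in> I \<Longrightarrow> \<delta> i (x i) \<noteq> 0"
    "\<And>i j. i \<in> I \<Longrightarrow> j \<in> I \<Longrightarrow> j \<noteq> i \<Longrightarrow> \<delta> i (x j) = 0"
    by metis
  have "(\<Sum>i\<in>I. (v i / \<delta> i (x i)) * \<delta> i (x j)) = v j" if "j \<in> I" for j
  proof -
    have "(\<Sum>i\<in>I. (v i / \<delta> i (x i)) * \<delta> i (x j)) = (\<Sum>i\<in>I. if i = j then v j else 0)"
      using that d by (intro sum.cong) auto
    then show ?thesis using I that by simp
  qed
  then show "\<exists>\<delta>. derivation \<delta> \<and> (\<forall>i\<in>I. \<delta> (x i) = v i)"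
    using derivation_sum[OF I d(1), where c = "\<lambda>i. v i / \<delta> i (x i)"]
    by (intro exI[of _ "\<lambda>z. \<Sum>i\<in>I. (v i / \<delta> i (x i)) * \<delta> i z"]) auto
qed

lemma diff_indep_if_not_in_closure:
  assumes "finite I" "\<And>i. i \<in> I \<Longrightarrow> x i \<notin> diff_closure (x ` (I - {i}))"
  shows "diff_indep I x"
proof (rule diff_indep_if_dual_derivations[OF assms(1)])
  fix i assume "i \<in> I"
  from assms(2)[OF this]
  show "\<exists>\<delta>. derivation \<delta> \<and> \<delta> (x i) \<noteq> 0 \<and> (\<forall>j\<in>I. j \<noteq> i \<longrightarrow> \<delta> (x j) = 0)"
    by (auto simp: diff_closure_def)
qed

lemma alg_indep_imp_diff_indep:
  assumes "alg_indep I x" "finite I"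
  shows "diff_indep I x"
proof (rule diff_indep_if_dual_derivations[OF assms(2)])
  fix i assume "i \<in> I"
  then obtain \<delta> where "derivation \<delta>" "\<delta> (x i) = 1" "\<And>j. j \<in> I \<Longrightarrow> j \<noteq> i \<Longrightarrow> \<delta> (x j) = 0"
    using alg_indep_derivation[OF assms] by metis
  then show "\<exists>\<delta>. derivation \<delta> \<and> \<delta> (x i) \<noteq> 0 \<and> (\<forall>j\<in>I. j \<noteq> i \<longrightarrow> \<delta> (x j) = 0)"
    by (intro exI[of _ \<delta>]) auto
qed

lemma diff_indep_not_in_closure:
  assumes "diff_indep I x" "i \<in> I"
  shows "x i \<notin> diff_closure {}"
proof -
  obtain \<delta> where "derivation \<delta>" "\<delta> (x i) = 1"
    using diff_indepE[OF assms(1), of "\<lambda>_. 1"] assms(2) by blast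
  then show ?thesis by (auto simp: diff_closure_def)
qed

lemma steinitz_relative:
  assumes "finite S" "finite I" "x ` I \<subseteq> diff_closure (B \<union> S)"
    and "\<forall>v. \<exists>\<delta>. derivation \<delta> \<and> (\<forall>b\<in>B. \<delta> b = 0) \<and> (\<forall>i\<in>I. \<delta> (x i) = v i)"
  shows "card I \<le> card S"
  using assms
proof (induction S arbitrary: B I rule: finite_induct)
  case empty
  have "i \<notin> I" for i
  proof
    assume i: "i \<in> I"
    obtain \<delta> where "derivation \<delta>" "\<forall>b\<in>B. \<delta> b = 0" "\<forall>i\<in>I. \<delta> (x i) = 1"
      using empty.prems(3)[rule_format, of "\<lambda>_. 1"] by blast
    moreover have "x i \<in> diff_closure B" using empty.prems(2) i by auto
    ultimately show False using diff_closureD[of "x i" B \<delta>] i by auto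
  qed
  then show ?case by (metis card.empty equals0I order_refl)
next
  case (insert s S)
  show ?case
  proof (cases "x ` I \<subseteq> diff_closure (B \<union> S)")
    case True
    then have "card I \<le> card S" using insert.IH[of I B] insert.prems by blast
    then show ?thesis using insert.hyps by simp
  next
    case False
    then obtain i where i: "i \<in> I" "x i \<notin> diff_closure (B \<union> S)" by auto
    have "x i \<in> diff_closure (insert s (B \<union> S))" using insert.prems(2) i(1) by auto
    then have s: "s \<in> diff_closure (insert (x i) (B \<union> S))"
      using diff_closure_exchange i(2) by blast
    have "card (I - {i}) \<le> card S"
    proof (rule insert.IH[of _ "insert (x i) B"])
      show "finite (I - {i})" using insert.prems by simp
      have "B \<union> insert s S \<subseteq> diff_closure (insert (x i) B \<union> S)"
        using s diff_closure_incl by auto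
      then show "x ` (I - {i}) \<subseteq> diff_closure (insert (x i) B \<union> S)"
        using insert.prems(2) diff_closure_trans by blast
      show "\<forall>v. \<exists>\<delta>. derivation \<delta> \<and> (\<forall>b\<in>insert (x i) B. \<delta> b = 0) \<and> (\<forall>i\<in>I - {i}. \<delta> (x i) = v i)"
      proof
        fix v
        \<comment> \<open>Prescribing 0 at \<open>i\<close> makes the derivation kill
          \<open>x i\<close>, which now belongs to the base.\<close>
        obtain \<delta> where "derivation \<delta>" "\<forall>b\<in>B. \<delta> b = 0" "\<forall>j\<in>I. \<delta> (x j) = (v(i := 0)) j"
          using insert.prems(3) by blast
        then show "\<exists>\<delta>. derivation \<delta> \<and> (\<forall>b\<in>insert (x i) B. \<delta> b = 0) \<and> (\<forall>i\<in>I - {i}. \<delta> (x i) = v i)"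
          using i(1) by (intro exI[of _ \<delta>]) auto
      qed
    qed
    then show ?thesis using insert.hyps insert.prems(1) i(1) by simp
  qed
qed

lemma diff_indep_card_le:
  assumes "diff_indep I x" "finite I" "finite S" "x ` I \<subseteq> diff_closure S"
  shows "card I \<le> card S"
  using assms steinitz_relative[of S I x "{}"] by (simp add: diff_indep_def)

text \<open>As \<open>d\<close> is transcendental, some derivation \<open>\<eta>\<close> moves it,
  and a multiple \<open>t * \<eta>\<close> gives it any desired value. A derivation that copies
  \<open>t * \<eta>\<close> on the family over \<open>A\<close> must agree with it on
  \<open>d\<close>, while its values on \<open>B - {e}\<close> remain free.\<close>

lemma diff_indep_glue:
  assumes ind: "diff_indep (A \<union> (B - {e})) x" and disj: "A \<inter> (B - {e}) = {}"
    and d: "d \<in> diff_closure (x ` A)" "d \<notin> diff_closure {}"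
  shows "diff_indep B (x(e := d))"
  unfolding diff_indep_def
proof
  fix v
  obtain \<eta> where \<eta>: "derivation \<eta>" "\<eta> d \<noteq> 0" using d(2) by (auto simp: diff_closure_def)
  define t where "t = v e / \<eta> d"
  obtain \<delta> where \<delta>: "derivation \<delta>"
    "\<And>i. i \<in> A \<union> (B - {e}) \<Longrightarrow> \<delta> (x i) = (if i \<in> A then t * \<eta> (x i) else v i)"
    using diff_indepE[OF ind, of "\<lambda>i. if i \<in> A then t * \<eta> (x i) else v i"] by blast
  have "1 * \<delta> d + (- t) * \<eta> d = 0"
    using derivation_combination[OF \<delta>(1) \<eta>(1), of 1 "- t"] \<delta>(2)
    by (intro diff_closureD[OF d(1), of "\<lambda>z. 1 * \<delta> z + (- t) * \<eta> z"]) auto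
  then have "\<delta> d = v e" using \<eta>(2) by (simp add: t_def)
  moreover have "\<delta> (x i) = v i" if "i \<in> B" "i \<noteq> e" for i using \<delta>(2) disj that by auto
  ultimately show "\<exists>\<delta>. derivation \<delta> \<and> (\<forall>i\<in>B. \<delta> ((x(e := d)) i) = v i)"
    using \<delta>(1) by (intro exI[of _ \<delta>]) auto
qed

section \<open>Independent edge lengths\<close>

definition idist :: "('a \<Rightarrow> complex \<times> complex) \<Rightarrow> 'a \<Rightarrow> 'a \<Rightarrow> complex" where
  "idist q x y = (fst (q x) - fst (q y)) * (snd (q x) - snd (q y))"

definition realises :: "'a set set \<Rightarrow> ('a set \<Rightarrow> complex) \<Rightarrow> ('a \<Rightarrow> complex \<times> complex) \<Rightarrow> bool" where
  "realises E l q \<longleftrightarrow> (\<forall>x y. {x, y} \<in> E \<longrightarrow> idist q x y = l {x, y})"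

lemma idist_commute: "idist q x y = idist q y x"
  by (simp add: idist_def algebra_simps)

lemma idist_self [simp]: "idist q x x = 0"
  by (simp add: idist_def)

text \<open>The deleted edge is restored with the length that \<open>q\<close> itself gives it, so
  its constraint holds automatically. This splits a realisation of the glued graph into realisations
  of two members of the family.\<close>

lemma realises_glue:
  "realises (E1 \<union> (E2 - {{u, v}})) l q \<longleftrightarrow>
     realises E1 l q \<and> realises E2 (l({u, v} := idist q u v)) q"
proof -
  have uv: "idist q x y = idist q u v" if "{x, y} = {u, v}" for x y
    using that idist_commute[of q u v] by (auto simp: doubleton_eq_iff)
  have "realises E2 (l({u, v} := idist q u v)) q \<longleftrightarrow> realises (E2 - {{u, v}}) l q"
    unfolding realises_def
  proof (intro iff_allI)
    fix x y
    show "({x, y} \<in> E2 \<longrightarrow> idist q x y = (l({u, v} := idist q u v)) {x, y}) \<longleftrightarrow>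
        ({x, y} \<in> E2 - {{u, v}} \<longrightarrow> idist q x y = l {x, y})"
      using uv[of x y] by (cases "{x, y} = {u, v}") simp_all
  qed
  moreover have "realises (E1 \<union> (E2 - {{u, v}})) l q \<longleftrightarrow>
      realises E1 l q \<and> realises (E2 - {{u, v}}) l q"
    unfolding realises_def by (simp only: Un_iff) metis
  ultimately show ?thesis by simp
qed

text \<open>The translation taking \<open>u\<close> to the origin, followed by the linear isometry
  of the form \<open>z * w\<close> with factor \<open>t\<close>.\<close>

definition boost :: "'a \<Rightarrow> complex \<Rightarrow> ('a \<Rightarrow> complex \<times> complex) \<Rightarrow> 'a \<Rightarrow> complex \<times> complex" where
  "boost u t q x = ((fst (q x) - fst (q u)) * t, (snd (q x) - snd (q u)) / t)"

lemma idist_boost: "t \<noteq> 0 \<Longrightarrow> idist (boost u t q) x y = idist q x y"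
  by (simp add: idist_def boost_def flip: left_diff_distrib diff_divide_distrib)

lemma boost_base: "boost u t q u = (0, 0)"
  by (simp add: boost_def)

section \<open>Vertices and edges of the graphs in Q\<close>

lemma Q_graph_finite: "Q_graph V E \<Longrightarrow> finite V"
  by (induction rule: Q_graph.induct) auto

lemma Q_graph_edge:
  "Q_graph V E \<Longrightarrow> e \<in> E \<Longrightarrow> \<exists>x y. e = {x, y} \<and> x \<noteq> y \<and> x \<in> V \<and> y \<in> V"
  by (induction rule: Q_graph.induct) (blast+)

lemma Q_graph_finite_edges: "Q_graph V E \<Longrightarrow> finite E"
  by (induction rule: Q_graph.induct) auto

text \<open>An edge common to both parts lies inside \<open>V1 \<inter> V2\<close> and so equals
  \<open>{u, v}\<close>. Hence edge counts add up and the lengths on the two sides form separate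
  families.\<close>

lemma Q_graph_edge_disjoint:
  assumes "Q_graph V1 E1" "Q_graph V2 E2" "V1 \<inter> V2 = {u, v}"
  shows "E1 \<inter> (E2 - {{u, v}}) = {}"
proof -
  have False if e: "e \<in> E1" "e \<in> E2" "e \<noteq> {u, v}" for e
  proof -
    obtain x y where xy: "e = {x, y}" "x \<noteq> y" "x \<in> V1" "y \<in> V1"
      using Q_graph_edge[OF assms(1) e(1)] by blast
    moreover have "e \<subseteq> V2" using Q_graph_edge[OF assms(2) e(2)] by blast
    ultimately have "{x, y} \<subseteq> {u, v}" using assms(3) by blast
    then show False using xy e(3) by blast
  qed
  then show ?thesis by blast
qed

text \<open>Gluing loses two vertices and one edge from the totals, which preserves the count
  \<open>2 * n - 3\<close>. The additive form avoids truncated subtraction.\<close>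

lemma Q_graph_card:
  "Q_graph V E \<Longrightarrow> 3 \<le> card V \<and> card E + 3 = 2 * card V"
proof (induction rule: Q_graph.induct)
  case (K3 a b c)
  then have "card {a, b, c} = 3" "card {{a, b}, {b, c}, {a, c}} = 3"
    by (auto simp: doubleton_eq_iff)
  then show ?case by simp
next
  case (glue V1 E1 V2 E2 u v)
  have V: "card (V1 \<union> V2) + 2 = card V1 + card V2"
    using card_Un_Int[of V1 V2] glue.hyps Q_graph_finite[OF glue.hyps(1)] Q_graph_finite[OF glue.hyps(2)]
    by simp
  have "card (E1 \<union> (E2 - {{u, v}})) = card E1 + card (E2 - {{u, v}})"
    using glue Q_graph_finite_edges by (intro card_Un_disjoint Q_graph_edge_disjoint) auto
  moreover have "card (E2 - {{u, v}}) + 1 = card E2"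
    using glue Q_graph_finite_edges card_Suc_Diff1[of E2 "{u, v}"] by simp
  ultimately show ?case using V glue by simp
qed

text \<open>With \<open>u\<close> at the origin and \<open>v\<close> at \<open>(1, d)\<close>, a point \<open>(Z, W)\<close> at given distances from \<open>u\<close> and
  \<open>v\<close> has \<open>Z * d\<close> and \<open>W\<close> as the two roots of a quadratic.\<close>

lemma pinned_coordinates_in_closure:
  assumes q: "q u = (0, 0)" "fst (q v) = 1"
    and d: "idist q u v \<in> diff_closure S" "idist q u v \<noteq> 0"
    and x: "idist q u x \<in> diff_closure S" "idist q v x \<in> diff_closure S"
  shows "fst (q x) \<in> diff_closure S" "snd (q x) \<in> diff_closure S"
proof -
  define d a b Z W where "d = idist q u v" "a = idist q u x" "b = idist q v x"
    "Z = fst (q x)" "W = snd (q x)"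
  note defs = this
  have dv: "snd (q v) = d" using q by (simp add: defs idist_def)
  have a: "a = Z * W" using q by (simp add: defs idist_def)
  have b: "b = (1 - Z) * (d - W)" using q dv by (simp add: defs(3-5) idist_def)
  have W: "W * W + (0 - (a + d - b)) * W + a * d = 0" by (simp add: a b algebra_simps)
  have mem: "a \<in> diff_closure S" "b \<in> diff_closure S" "d \<in> diff_closure S"
    using assms by (simp_all add: defs)
  show W': "snd (q x) \<in> diff_closure S"
    using W mem unfolding defs(5)[symmetric]
    by (intro diff_closure_quadratic[OF _ _ W] diff_closure_diff diff_closure_add
        diff_closure_mult diff_closure_0)
  have "d * Z = a + d - b - W" by (simp add: a b algebra_simps)
  moreover have "a + d - b - W \<in> diff_closure S"
    using mem W' unfolding defs(5) by (intro diff_closure_diff diff_closure_add)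
  ultimately show "fst (q x) \<in> diff_closure S"
    using mem d(2) unfolding defs(4)[symmetric]
    by - (rule diff_closure_cancel[of d], auto simp: defs(1))
qed

text \<open>Since \<open>u\<close> and \<open>v\<close> have nonzero distance, a boost pins them.
  The pinned coordinates of \<open>x\<close> and \<open>y\<close> are then algebraic over the given
  distances, and so is the distance between them.\<close>

lemma idist_cross_in_closure:
  assumes d: "idist q u v \<in> diff_closure S" "idist q u v \<noteq> 0"
    and "idist q u x \<in> diff_closure S" "idist q v x \<in> diff_closure S"
    and "idist q u y \<in> diff_closure S" "idist q v y \<in> diff_closure S"
  shows "idist q x y \<in> diff_closure S"
proof -
  have z: "fst (q v) - fst (q u) \<noteq> 0" using d(2) by (auto simp: idist_def)
  define r where "r = boost u (1 / (fst (q v) - fst (q u))) q"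
  have r: "r u = (0, 0)" "fst (r v) = 1" using z by (simp_all add: r_def boost_def)
  have D: "idist r = idist q" using z by (intro ext) (simp add: r_def idist_boost)
  have "fst (r x) \<in> diff_closure S" "snd (r x) \<in> diff_closure S"
       "fst (r y) \<in> diff_closure S" "snd (r y) \<in> diff_closure S"
    using pinned_coordinates_in_closure[of r u v S, OF r] assms by (simp_all add: D)
  then have "idist r x y \<in> diff_closure S"
    unfolding idist_def by (intro diff_closure_mult diff_closure_diff)
  then show ?thesis by (simp add: D)
qed

text \<open>The first part already yields the distance of \<open>u\<close> and \<open>v\<close>,
  which serves as the restored edge length in the second part. A pair across the parts is reached
  through its distances to \<open>u\<close> and \<open>v\<close>.\<close>

lemma Q_graph_distances_in_closure:
  assumes "Q_graph V E" "realises E l q"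
    and "\<And>x y. x \<in> V \<Longrightarrow> y \<in> V \<Longrightarrow> x \<noteq> y \<Longrightarrow> idist q x y \<noteq> 0" "x \<in> V" "y \<in> V"
  shows "idist q x y \<in> diff_closure (l ` E)"
  using assms
proof (induction arbitrary: l x y rule: Q_graph.induct)
  case (K3 a b c)
  show ?case
  proof (cases "x = y")
    case True then show ?thesis by (simp add: diff_closure_0)
  next
    case False
    then have e: "{x, y} \<in> {{a, b}, {b, c}, {a, c}}" using K3.prems(3,4) by (auto simp: doubleton_eq_iff)
    have "idist q x y = l {x, y}" using K3.prems(1) e by (simp only: realises_def)
    moreover have "l {x, y} \<in> l ` {{a, b}, {b, c}, {a, c}}" using e by (rule imageI)
    ultimately show ?thesis using diff_closure_incl by metis
  qed
next
  case (glue V1 E1 V2 E2 u v)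
  let ?E = "E1 \<union> (E2 - {{u, v}})"
  let ?K = "diff_closure (l ` ?E)"
  have uv: "u \<in> V1" "v \<in> V1" "u \<in> V2" "v \<in> V2" using glue.hyps by auto
  have in1: "idist q x y \<in> ?K" if "x \<in> V1" "y \<in> V1" for x y
  proof -
    have "idist q x y \<in> diff_closure (l ` E1)"
      using glue.prems that by (intro glue.IH(1)) (auto simp: realises_def)
    then show ?thesis by (rule diff_closure_mono[rotated]) auto
  qed
  define l' where "l' = l({u, v} := idist q u v)"
  have in2: "idist q x y \<in> ?K" if "x \<in> V2" "y \<in> V2" for x y
  proof -
    have "realises E2 l' q"
      using glue.prems(1) by (simp only: realises_glue l'_def)
    then have "idist q x y \<in> diff_closure (l' ` E2)"
      using glue.prems that by (intro glue.IH(2)) auto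
    moreover have "l' ` E2 \<subseteq> ?K"
      using in1[OF uv(1,2)] by (auto simp: l'_def intro: diff_closure_incl)
    ultimately show ?thesis by (rule diff_closure_trans[rotated])
  qed
  have cross: "idist q x y \<in> ?K" if "x \<in> V1" "y \<in> V2" for x y
    by (rule idist_cross_in_closure[of q u v])
      (use that uv glue.prems(2)[of u v] glue.hyps(4) in \<open>auto intro: in1 in2\<close>)
  show ?case
    using in1[of x y] in2[of x y] cross[of x y] cross[of y x] glue.prems(3,4) idist_commute[of q x y]
    by (metis Un_iff)
qed

text \<open>Lengths are polynomials in the coordinates, so anything generating the coordinates
  algebraically generates the lengths, and exchange applies.\<close>

lemma diff_indep_edges_card_le:
  assumes G: "Q_graph V E" and ind: "diff_indep E l" and q: "realises E l q" and S: "finite S"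
    and mem: "\<And>x. x \<in> V \<Longrightarrow> fst (q x) \<in> diff_closure S \<and> snd (q x) \<in> diff_closure S"
  shows "card E \<le> card S"
proof (rule diff_indep_card_le[OF ind Q_graph_finite_edges[OF G] S])
  show "l ` E \<subseteq> diff_closure S"
  proof
    fix d assume "d \<in> l ` E"
    then obtain e where e: "e \<in> E" "d = l e" by auto
    then obtain x y where xy: "e = {x, y}" "x \<in> V" "y \<in> V" using Q_graph_edge[OF G] by blast
    then have "d = idist q x y" using q e by (auto simp: realises_def)
    then show "d \<in> diff_closure S"
      using mem xy unfolding idist_def by (auto intro!: diff_closure_mult diff_closure_diff)
  qed
qed

lemma card_coordinates_le:
  assumes "finite A"
  shows "finite ((\<lambda>x. fst (q x)) ` A \<union> (\<lambda>x. snd (q x)) ` A)"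
    and "card ((\<lambda>x. fst (q x)) ` A \<union> (\<lambda>x. snd (q x)) ` A) \<le> 2 * card A"
proof -
  show "card ((\<lambda>x. fst (q x)) ` A \<union> (\<lambda>x. snd (q x)) ` A) \<le> 2 * card A"
    using card_Un_le[of "(\<lambda>x. fst (q x)) ` A" "(\<lambda>x. snd (q x)) ` A"]
      card_image_le[OF assms, of "\<lambda>x. fst (q x)"] card_image_le[OF assms, of "\<lambda>x. snd (q x)"]
    by linarith
qed (use assms in auto)

text \<open>If the distance were algebraic, a suitable boost would make \<open>v\<close> algebraic, leaving only
  \<open>2 * card V - 4\<close> coordinates to generate \<open>2 * card V - 3\<close> independent lengths.\<close>

lemma idist_transcendental:
  assumes G: "Q_graph V E" and ind: "diff_indep E l" and q: "realises E l q"
    and uv: "u \<in> V" "v \<in> V" "u \<noteq> v"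
  shows "idist q u v \<notin> diff_closure {}"
proof
  assume alg: "idist q u v \<in> diff_closure {}"
  \<comment> \<open>If the z-coordinates differ, their difference is scaled to 1 and the other
    difference becomes the distance, algebraic by assumption. If only the w-coordinates differ, that
    difference is scaled to 1. Coincident points are left alone.\<close>
  have "\<exists>t. t \<noteq> 0 \<and> fst (boost u t q v) \<in> diff_closure {} \<and> snd (boost u t q v) \<in> diff_closure {}"
  proof (cases "fst (q u) = fst (q v)")
    case False
    then have "snd (boost u (1 / (fst (q v) - fst (q u))) q v) = idist q u v"
      by (simp add: boost_def idist_def algebra_simps)
    then show ?thesis using False alg
      by (intro exI[of _ "1 / (fst (q v) - fst (q u))"]) (simp add: boost_def diff_closure_1)
  next
    case eq: True
    show ?thesis
    proof (cases "snd (q u) = snd (q v)")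
      case True
      then show ?thesis using eq by (intro exI[of _ 1]) (simp add: boost_def diff_closure_0)
    next
      case False
      then show ?thesis using eq
        by (intro exI[of _ "snd (q v) - snd (q u)"])
          (simp add: boost_def diff_closure_0 diff_closure_1)
    qed
  qed
  then obtain t where t: "t \<noteq> 0" "fst (boost u t q v) \<in> diff_closure {}"
    "snd (boost u t q v) \<in> diff_closure {}" by blast
  define r where "r = boost u t q"
  have r: "realises E l r" using q t(1) by (simp add: realises_def r_def idist_boost)
  let ?A = "V - {u, v}"
  let ?S = "(\<lambda>x. fst (r x)) ` ?A \<union> (\<lambda>x. snd (r x)) ` ?A"
  have A: "finite ?A" using Q_graph_finite[OF G] by simp
  have "fst (r x) \<in> diff_closure ?S \<and> snd (r x) \<in> diff_closure ?S" if x: "x \<in> V" for x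
  proof (cases "x = u \<or> x = v")
    case True
    then show ?thesis
      using t(2,3) diff_closure_mono[of "{}" ?S] boost_base[of u t q]
      by (auto simp: r_def diff_closure_0)
  next
    case False
    then show ?thesis using x by (auto intro!: diff_closure_incl)
  qed
  then have "card E \<le> card ?S"
    using diff_indep_edges_card_le[OF G ind r] card_coordinates_le(1)[OF A] by blast
  also have "\<dots> \<le> 2 * card ?A" by (rule card_coordinates_le(2)[OF A])
  also have "card ?A = card V - 2" using uv Q_graph_finite[OF G] by (simp add: card_Diff_subset)
  finally show False using Q_graph_card[OF G] by arith
qed

lemma idist_nonzero:
  assumes "Q_graph V E" "diff_indep E l" "realises E l q" "u \<in> V" "v \<in> V" "u \<noteq> v"
  shows "idist q u v \<noteq> 0"
  using idist_transcendental[OF assms] diff_closure_0 by metis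

text \<open>On the line through the origin and \<open>q v\<close> the second coordinate of
  \<open>w\<close> is determined by the first. Then \<open>snd (q v)\<close>,
  \<open>fst (q w)\<close> and \<open>2 * (card V - 3)\<close> further coordinates generate
  everything, one fewer than the number of independent lengths.\<close>

lemma pinned_not_collinear:
  assumes G: "Q_graph V E" and ind: "diff_indep E l" and q: "realises E l q"
    and V: "u \<in> V" "v \<in> V" "w \<in> V" "u \<noteq> v" "u \<noteq> w" "v \<noteq> w"
    and pin: "q u = (0, 0)" "fst (q v) = 1"
  shows "fst (q w) * snd (q v) \<noteq> snd (q w)"
proof
  assume col: "fst (q w) * snd (q v) = snd (q w)"
  let ?A = "V - {u, v, w}"
  let ?S = "(\<lambda>x. fst (q x)) ` ?A \<union> (\<lambda>x. snd (q x)) ` ?A"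
  let ?T = "{snd (q v), fst (q w)} \<union> ?S"
  have A: "finite ?A" using Q_graph_finite[OF G] by simp
  have T: "snd (q v) \<in> diff_closure ?T" "fst (q w) \<in> diff_closure ?T"
    by (auto intro: diff_closure_incl)
  have "fst (q x) \<in> diff_closure ?T \<and> snd (q x) \<in> diff_closure ?T" if x: "x \<in> V" for x
  proof -
    consider "x = u" | "x = v" | "x = w" | "x \<in> ?A" using x by blast
    then show ?thesis
    proof cases
      case 1 then show ?thesis using pin by (simp add: diff_closure_0)
    next
      case 2 then show ?thesis using pin T by (simp add: diff_closure_1)
    next
      case 3
      then show ?thesis using diff_closure_mult[OF T(2,1)] T(2) col by simp
    next
      case 4
      then show ?thesis by (auto intro!: diff_closure_incl)
    qed
  qed
  then have "card E \<le> card ?T"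
    using card_coordinates_le(1)[OF A, of q] by (intro diff_indep_edges_card_le[OF G ind q]) auto
  also have "\<dots> \<le> card {snd (q v), fst (q w)} + card ?S" by (rule card_Un_le)
  also have "\<dots> \<le> 2 + 2 * card ?A"
    using card_coordinates_le(2)[OF A, of q] by (intro add_mono) (auto simp: card_insert_if)
  also have "card ?A = card V - 3" using V Q_graph_finite[OF G] by (simp add: card_Diff_subset)
  finally show False using Q_graph_card[OF G] by arith
qed

section \<open>Generic realisations have independent edge lengths\<close>

definition isotropic :: "complex \<times> complex \<Rightarrow> complex \<times> complex" where
  "isotropic P = (fst P + \<i> * snd P, fst P - \<i> * snd P)"

lemma sqd_eq_idist: "sqd p x y = idist (isotropic \<circ> p) x y"
  by (simp add: sqd_def idist_def isotropic_def algebra_simps power2_eq_square)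

text \<open>If one length depended on the others, those \<open>2 * card V - 4\<close> lengths and
  three placement parameters would generate all \<open>2 * card V\<close> independent coordinates of
  \<open>p\<close>.\<close>

lemma generic_lengths_indep:
  assumes G: "Q_graph V E" and p: "generic_real V p" and l: "realises E l (isotropic \<circ> p)"
  shows "diff_indep E l"
proof (rule diff_indep_if_not_in_closure[OF Q_graph_finite_edges[OF G]], rule notI)
  fix e assume e: "e \<in> E" and dep: "l e \<in> diff_closure (l ` (E - {e}))"
  define I where "I = V \<times> (UNIV :: bool set)"
  define c where "c = (\<lambda>(v, b). if b then fst (p v) else snd (p v))"
  define q where "q = isotropic \<circ> p"
  have finV: "finite V" by (rule Q_graph_finite[OF G])
  have finI: "finite I" using finV by (simp add: I_def)
  have ind: "diff_indep I c"
    using p finI unfolding generic_real_def I_def[symmetric] c_def[symmetric]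
    by (rule alg_indep_imp_diff_indep)
  have nz: "idist q x y \<noteq> 0" if xy: "x \<in> V" "y \<in> V" "x \<noteq> y" for x y
  proof -
    \<comment> \<open>The partial derivative in the first Euclidean coordinate of \<open>x\<close>
      is 1 on both isotropic differences, so neither of them vanishes.\<close>
    obtain \<delta> where d: "derivation \<delta>" "\<And>i. i \<in> I \<Longrightarrow> \<delta> (c i) = (if i = (x, True) then 1 else 0)"
      using diff_indepE[OF ind, of "\<lambda>i. if i = (x, True) then 1 else 0"] by blast
    have i: "\<delta> \<i> = 0" using diff_closureD[OF diff_closure_ii[of "{}"] d(1)] by simp
    have "\<delta> (fst (p x)) = 1" "\<delta> (snd (p x)) = 0" "\<delta> (fst (p y)) = 0" "\<delta> (snd (p y)) = 0"
      using d(2)[of "(x, True)"] d(2)[of "(x, False)"] d(2)[of "(y, True)"] d(2)[of "(y, False)"] xy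
      by (auto simp: I_def c_def)
    then have "\<delta> (fst (q x) - fst (q y)) = 1" "\<delta> (snd (q x) - snd (q y)) = 1"
      using i d(1)
      by (simp_all add: q_def isotropic_def derivation_add[OF d(1)] derivation_diff[OF d(1)]
          derivation_mult[OF d(1)])
    then have "fst (q x) - fst (q y) \<noteq> 0" "snd (q x) - snd (q y) \<noteq> 0"
      using derivation_0[OF d(1)] by (metis zero_neq_one)+
    then show ?thesis unfolding idist_def by simp
  qed
  obtain u v where uv: "u \<in> V" "v \<in> V" "u \<noteq> v" using Q_graph_edge[OF G e] by blast
  define t where "t = fst (q v) - fst (q u)"
  have t: "t \<noteq> 0" using nz[OF uv] by (auto simp: t_def idist_def)
  \<comment> \<open>The three added parameters undo the pinning: \<open>q u\<close> recovers the
    translation and \<open>t\<close> the boost.\<close>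
  define S where "S = l ` (E - {e}) \<union> {fst (q u), snd (q u), t}"
  have S: "fst (q u) \<in> diff_closure S" "snd (q u) \<in> diff_closure S" "t \<in> diff_closure S"
    by (auto simp: S_def intro: diff_closure_incl)
  have "l e \<in> diff_closure S" by (rule diff_closure_mono[OF _ dep]) (auto simp: S_def)
  then have lS: "l ` E \<subseteq> diff_closure S" by (auto simp: S_def intro: diff_closure_incl)
  have D: "idist q x y \<in> diff_closure S" if "x \<in> V" "y \<in> V" for x y
    by (rule diff_closure_trans[OF lS Q_graph_distances_in_closure[OF G l[folded q_def] nz that]])
  define r where "r = boost u (1 / t) q"
  have r: "r u = (0, 0)" "fst (r v) = 1" using t by (simp_all add: r_def boost_def t_def)
  have rD: "idist r = idist q" using t by (intro ext) (simp add: r_def idist_boost)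
  have qS: "fst (q x) \<in> diff_closure S \<and> snd (q x) \<in> diff_closure S" if x: "x \<in> V" for x
  proof -
    have "fst (r x) \<in> diff_closure S" "snd (r x) \<in> diff_closure S"
      using pinned_coordinates_in_closure[of r u v S x, OF r] D x uv nz[OF uv] by (simp_all add: rD)
    moreover have "fst (q x) = fst (q u) + fst (r x) * t" "snd (q x) = snd (q u) + snd (r x) / t"
      using t by (simp_all add: r_def boost_def)
    ultimately show ?thesis
      using S by (auto intro!: diff_closure_add diff_closure_mult diff_closure_divide)
  qed
  have "c ` I \<subseteq> diff_closure S"
  proof
    fix a assume "a \<in> c ` I"
    then obtain x where x: "x \<in> V" "a = fst (p x) \<or> a = snd (p x)" by (auto simp: I_def c_def)
    have "2 * fst (p x) = fst (q x) + snd (q x)" "(2 * \<i>) * snd (p x) = fst (q x) - snd (q x)"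
      by (simp_all add: q_def isotropic_def)
    then have "2 * fst (p x) \<in> diff_closure S" "(2 * \<i>) * snd (p x) \<in> diff_closure S"
      using qS[OF x(1)] by (auto intro: diff_closure_add diff_closure_diff)
    then have "fst (p x) \<in> diff_closure S" "snd (p x) \<in> diff_closure S"
      using diff_closure_cancel[OF diff_closure_2, where S = S and y = "fst (p x)"]
        diff_closure_cancel[OF diff_closure_mult[OF diff_closure_2 diff_closure_ii],
          where S = S and y = "snd (p x)"]
      by simp_all
    then show "a \<in> diff_closure S" using x(2) by auto
  qed
  then have "card I \<le> card S"
    using Q_graph_finite_edges[OF G] by (intro diff_indep_card_le[OF ind finI]) (auto simp: S_def)
  also have "\<dots> \<le> card (l ` (E - {e})) + card {fst (q u), snd (q u), t}"
    unfolding S_def by (rule card_Un_le)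
  also have "\<dots> \<le> card (E - {e}) + 3"
    using Q_graph_finite_edges[OF G]
    by (intro add_mono card_image_le) (auto simp: card_insert_if)
  also have "\<dots> < card E + 3" using card_Diff1_less[OF Q_graph_finite_edges[OF G] e] by simp
  finally show False using Q_graph_card[OF G] by (simp add: I_def card_cartesian_product)
qed

section \<open>Counting pinned realisations\<close>

text \<open>An invariant that stands for a congruence class. Entries outside \<open>V\<close> are
  set to 0, so that equality of matrices compares distances on \<open>V\<close> only.\<close>

definition dist_matrix :: "'a set \<Rightarrow> ('a \<Rightarrow> complex \<times> complex) \<Rightarrow> 'a \<Rightarrow> 'a \<Rightarrow> complex" where
  "dist_matrix V q x y = (if x \<in> V \<and> y \<in> V then idist q x y else 0)"

definition dist_classes :: "'a set \<Rightarrow> 'a set set \<Rightarrow> ('a set \<Rightarrow> complex) \<Rightarrow> ('a \<Rightarrow> 'a \<Rightarrow> complex) set" where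
  "dist_classes V E l = dist_matrix V ` {q. realises E l q}"

text \<open>Values outside \<open>V\<close> are fixed so that pinned realisations can be counted.\<close>

definition pinned :: "'a set \<Rightarrow> 'a set set \<Rightarrow> ('a set \<Rightarrow> complex) \<Rightarrow> 'a \<Rightarrow> 'a \<Rightarrow>
    ('a \<Rightarrow> complex \<times> complex) set" where
  "pinned V E l u v =
     {q. realises E l q \<and> q u = (0, 0) \<and> fst (q v) = 1 \<and> (\<forall>x. x \<notin> V \<longrightarrow> q x = (0, 0))}"

lemma dist_matrix_eq_iff:
  "dist_matrix V q = dist_matrix V r \<longleftrightarrow> (\<forall>x\<in>V. \<forall>y\<in>V. idist q x y = idist r x y)"
proof
  assume "dist_matrix V q = dist_matrix V r"
  then have "dist_matrix V q x y = dist_matrix V r x y" for x y by simp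
  then show "\<forall>x\<in>V. \<forall>y\<in>V. idist q x y = idist r x y" by (metis dist_matrix_def)
qed (auto simp: dist_matrix_def fun_eq_iff)

lemma realises_cong:
  assumes "Q_graph V E" "\<And>x y. x \<in> V \<Longrightarrow> y \<in> V \<Longrightarrow> idist q x y = idist r x y"
  shows "realises E l q \<longleftrightarrow> realises E l r"
proof -
  have "idist q x y = idist r x y" if "{x, y} \<in> E" for x y
  proof -
    have "{x, y} \<subseteq> V" using Q_graph_edge[OF assms(1) that] by (metis empty_subsetI insert_subset)
    then show ?thesis using assms(2) by simp
  qed
  then show ?thesis by (auto simp: realises_def)
qed

lemma pinned_idist: "q \<in> pinned V E l u v \<Longrightarrow> idist q u v = snd (q v)"
  by (simp add: pinned_def idist_def)

text \<open>Independent lengths force a nonzero distance between \<open>u\<close> and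
  \<open>v\<close>, so every realisation can be translated, boosted and reset outside
  \<open>V\<close> to a pinned one with the same distances on \<open>V\<close>.\<close>

lemma dist_matrix_pinned:
  assumes G: "Q_graph V E" and ind: "diff_indep E l" and uv: "u \<in> V" "v \<in> V" "u \<noteq> v"
  shows "dist_matrix V ` pinned V E l u v = dist_classes V E l"
proof
  show "dist_matrix V ` pinned V E l u v \<subseteq> dist_classes V E l"
    by (auto simp: dist_classes_def pinned_def)
  show "dist_classes V E l \<subseteq> dist_matrix V ` pinned V E l u v"
  proof
    fix M assume "M \<in> dist_classes V E l"
    then obtain q where q: "realises E l q" "M = dist_matrix V q" by (auto simp: dist_classes_def)
    define t where "t = fst (q v) - fst (q u)"
    have t: "t \<noteq> 0" using idist_nonzero[OF G ind q(1) uv] by (auto simp: idist_def t_def)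
    define r where "r x = (if x \<in> V then boost u (1 / t) q x else (0, 0))" for x
    have D: "idist r x y = idist q x y" if "x \<in> V" "y \<in> V" for x y
    proof -
      have "idist r x y = idist (boost u (1 / t) q) x y" using that by (simp add: idist_def r_def)
      then show ?thesis using t by (simp add: idist_boost)
    qed
    have "realises E l r" using realises_cong[OF G D] q(1) by blast
    moreover have "r u = (0, 0)" "fst (r v) = 1"
      using uv t by (simp_all add: r_def boost_def t_def)
    ultimately have "r \<in> pinned V E l u v" by (simp add: pinned_def r_def)
    moreover have "M = dist_matrix V r" using D q(2) by (simp add: dist_matrix_eq_iff)
    ultimately show "M \<in> dist_matrix V ` pinned V E l u v" by blast
  qed
qed

text \<open>Reflection in the line through the origin and \<open>(1, d)\<close>.\<close>

definition mirror :: "complex \<Rightarrow> complex \<times> complex \<Rightarrow> complex \<times> complex" where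
  "mirror d P = (snd P / d, fst P * d)"

lemma idist_mirror: "d \<noteq> 0 \<Longrightarrow> idist (mirror d \<circ> q) x y = idist q x y"
  by (simp add: idist_def mirror_def flip: left_diff_distrib diff_divide_distrib)

lemma mirror_pinned:
  assumes "q \<in> pinned V E l u v" "snd (q v) = d" "d \<noteq> 0"
  shows "mirror d \<circ> q \<in> pinned V E l u v"
proof -
  have "realises E l (mirror d \<circ> q)"
    using assms unfolding pinned_def realises_def by (simp add: idist_mirror)
  then show ?thesis using assms by (simp add: pinned_def mirror_def)
qed

text \<open>The pairs \<open>Z * d\<close>, \<open>W\<close> and \<open>Z' * d\<close>,
  \<open>W'\<close> have equal sums and products, so they agree up to order; the swap is the
  reflection \<open>mirror d\<close>.\<close>

lemma pinned_point_cases: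
  fixes Z W Z' W' d :: complex
  assumes "d \<noteq> 0" "Z * W = Z' * W'" "(1 - Z) * (d - W) = (1 - Z') * (d - W')"
  shows "(Z', W') = (Z, W) \<or> (Z', W') = (W / d, Z * d)"
proof -
  have s: "Z * d + W = Z' * d + W'" using assms(2,3) by (simp add: algebra_simps)
  then have W': "W' = Z * d + W - Z' * d" by (simp add: algebra_simps)
  have "d * ((Z' - Z) * (Z' * d - W)) = 0"
    using assms(2) unfolding W' by (simp add: algebra_simps)
  then have "Z' = Z \<or> Z' * d = W" using assms(1) by simp
  then show ?thesis using W' assms(1) by (auto simp: field_simps)
qed

text \<open>The difference of the two distances factors as a multiple of
  \<open>(Z * d - W) * (Z' * d - W')\<close>: reflecting one of two points changes their distance
  unless one lies on the axis.\<close>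

lemma mirror_cross:
  fixes Z W Z' W' d :: complex
  assumes "d \<noteq> 0" "(Z - Z') * (W - W') = (Z - W' / d) * (W - Z' * d)" "Z * d \<noteq> W"
  shows "W' / d = Z'"
proof -
  have "d * ((Z - Z') * (W - W')) = (Z * d - W') * (W - Z' * d)"
    using assms(1,2) by (simp add: field_simps)
  then have "(Z * d - W) * (Z' * d - W') = 0" by (simp add: algebra_simps)
  then have "Z' * d = W'" using assms(3) by simp
  then show ?thesis using assms(1) by auto
qed

text \<open>The distances to \<open>u\<close> and \<open>v\<close> leave each vertex two mirror
  positions. A third vertex \<open>w\<close> off the axis ties all these choices to its own, leaving
  \<open>q\<close> and its reflection, which differ at \<open>w\<close>.\<close>

lemma pinned_fibre:
  assumes G: "Q_graph V E" and ind: "diff_indep E l" and uv: "u \<in> V" "v \<in> V" "u \<noteq> v"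
    and q: "q \<in> pinned V E l u v"
  shows "card {r \<in> pinned V E l u v. dist_matrix V r = dist_matrix V q} = 2"
proof -
  define d where "d = snd (q v)"
  have real: "realises E l r" if "r \<in> pinned V E l u v" for r using that by (simp add: pinned_def)
  have d0: "d \<noteq> 0"
    using idist_nonzero[OF G ind real[OF q] uv] pinned_idist[OF q] by (simp add: d_def)
  have "card {u, v} < card V" using Q_graph_card[OF G] uv(3) by simp
  then obtain w where w: "w \<in> V" "w \<noteq> u" "w \<noteq> v"
    using card_mono[of "{u, v}" V] by (metis finite.emptyI finite_insert insertCI leD subsetI)
  have noncol: "fst (r w) * snd (r v) \<noteq> snd (r w)" if "r \<in> pinned V E l u v" for r
    using that w
    by (intro pinned_not_collinear[OF G ind real[OF that] uv(1,2) w(1) uv(3)]) (auto simp: pinned_def)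
  have pts: "s x = r x \<or> s x = mirror d (r x)"
    if r: "r \<in> pinned V E l u v" "snd (r v) = d" and s: "s \<in> pinned V E l u v"
      and D: "dist_matrix V s = dist_matrix V r" for r s x
  proof (cases "x \<in> V")
    case False
    then show ?thesis using r s by (simp add: pinned_def)
  next
    case True
    have eq: "idist s y z = idist r y z" if "y \<in> V" "z \<in> V" for y z
      using D that by (simp add: dist_matrix_eq_iff)
    have sv: "snd (s v) = d"
      using eq[OF uv(1,2)] pinned_idist[OF s] pinned_idist[OF r(1)] r(2) by simp
    have "fst (r x) * snd (r x) = fst (s x) * snd (s x)"
      using eq[OF uv(1) True] r s by (simp add: pinned_def idist_def)
    moreover have "(1 - fst (r x)) * (d - snd (r x)) = (1 - fst (s x)) * (d - snd (s x))"
      using eq[OF uv(2) True] r s sv by (simp add: pinned_def idist_def)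
    ultimately show ?thesis
      using pinned_point_cases[OF d0] by (simp add: mirror_def prod_eq_iff)
  qed
  have same: "s = r"
    if r: "r \<in> pinned V E l u v" "snd (r v) = d" and s: "s \<in> pinned V E l u v"
      and D: "dist_matrix V s = dist_matrix V r" and sw: "s w = r w" for r s
  proof
    fix x
    show "s x = r x"
    proof (cases "x \<in> V")
      case False
      then show ?thesis using r s by (simp add: pinned_def)
    next
      case True
      have "idist r w x = idist s w x" using D w(1) True by (simp add: dist_matrix_eq_iff)
      \<comment> \<open>If \<open>s x\<close> is the reflected point, its unchanged distance to the
        off-axis point \<open>r w\<close> puts \<open>r x\<close> on the axis, where the reflection
        is the identity.\<close>
      then have "s x = r x" if m: "s x = mirror d (r x)"
      proof -
        have "(fst (r w) - fst (r x)) * (snd (r w) - snd (r x)) =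
            (fst (r w) - snd (r x) / d) * (snd (r w) - fst (r x) * d)"
          using \<open>idist r w x = idist s w x\<close> m sw by (simp add: idist_def mirror_def)
        then have "snd (r x) / d = fst (r x)"
          using mirror_cross[OF d0] noncol[OF r(1)] r(2) by blast
        then show ?thesis using m d0 by (auto simp: mirror_def prod_eq_iff field_simps)
      qed
      then show ?thesis using pts[OF r s D, of x] by blast
    qed
  qed
  let ?m = "mirror d \<circ> q"
  have m: "?m \<in> pinned V E l u v" using mirror_pinned[OF q _ d0] by (simp add: d_def)
  have mv: "snd (?m v) = d" using q by (simp add: mirror_def pinned_def)
  have mD: "dist_matrix V ?m = dist_matrix V q" by (simp add: dist_matrix_eq_iff idist_mirror[OF d0])
  have "{r \<in> pinned V E l u v. dist_matrix V r = dist_matrix V q} = {q, ?m}"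
  proof
    show "{r \<in> pinned V E l u v. dist_matrix V r = dist_matrix V q} \<subseteq> {q, ?m}"
    proof
      fix r assume "r \<in> {r \<in> pinned V E l u v. dist_matrix V r = dist_matrix V q}"
      then have r: "r \<in> pinned V E l u v" "dist_matrix V r = dist_matrix V q" by auto
      consider "r w = q w" | "r w = ?m w" using pts[OF q _ r, of w] d_def by auto
      then show "r \<in> {q, ?m}"
      proof cases
        case 1 then show ?thesis using same[OF q _ r] d_def by blast
      next
        case 2
        \<comment> \<open>With \<open>w\<close> reflected, the comparison is made with the mirror
          image of \<open>q\<close>, which is pinned and has the same distances.\<close>
        have "r = ?m" by (rule same[OF m mv r(1) _ 2]) (simp only: r(2) mD)
        then show ?thesis by blast
      qed
    qed
    show "{q, ?m} \<subseteq> {r \<in> pinned V E l u v. dist_matrix V r = dist_matrix V q}"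
      using q m mD by simp
  qed
  moreover have "q \<noteq> ?m"
  proof
    assume "q = ?m"
    then have "fst (q w) = snd (q w) / d" by (metis comp_apply fst_conv mirror_def)
    then show False using noncol[OF q] d0 by (simp add: d_def)
  qed
  ultimately show ?thesis by simp
qed

text \<open>Positivity of \<open>k\<close> makes the fibres finite, since \<open>card\<close> is 0
  on infinite sets. If the image is infinite, both sides are 0.\<close>

lemma card_eq_fibre_card_mult_image:
  assumes "\<And>q. q \<in> P \<Longrightarrow> card {r \<in> P. f r = f q} = k" "0 < k"
  shows "card P = k * card (f ` P)"
proof (cases "finite (f ` P)")
  case False
  then have "infinite P" using finite_imageI by blast
  then show ?thesis using False by simp
next
  case True
  have "P = (\<Union>c\<in>f ` P. {r \<in> P. f r = c})" by auto
  then have "card P = card (\<Union>c\<in>f ` P. {r \<in> P. f r = c})" by simp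
  also have "\<dots> = (\<Sum>c\<in>f ` P. card {r \<in> P. f r = c})"
  proof (rule card_UN_disjoint[OF True])
    show "\<forall>c\<in>f ` P. finite {r \<in> P. f r = c}"
      using assms by (auto intro!: card_ge_0_finite)
  qed auto
  also have "\<dots> = (\<Sum>c\<in>f ` P. k)" using assms(1) by (intro sum.cong) auto
  finally show ?thesis by simp
qed

lemma card_pinned:
  assumes "Q_graph V E" "diff_indep E l" "u \<in> V" "v \<in> V" "u \<noteq> v"
  shows "card (pinned V E l u v) = 2 * card (dist_classes V E l)"
  unfolding dist_matrix_pinned[OF assms, symmetric]
  by (rule card_eq_fibre_card_mult_image) (simp_all add: pinned_fibre[OF assms])

text \<open>The inverse restricts to the two vertex sets. Two pinned parts fit together because both
  have \<open>u\<close> at the origin and \<open>v\<close> at \<open>(1, d)\<close>, where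
  \<open>d\<close> is imposed on the second part as the length of \<open>{u, v}\<close>.\<close>

lemma pinned_glue_bij:
  assumes G1: "Q_graph V1 E1" and G2: "Q_graph V2 E2" and V: "V1 \<inter> V2 = {u, v}"
    and e: "{u, v} \<in> E2"
  shows "bij_betw (\<lambda>(q1, q2) x. if x \<in> V1 then q1 x else q2 x)
     (SIGMA q1:pinned V1 E1 l u v. pinned V2 E2 (l({u, v} := snd (q1 v))) u v)
     (pinned (V1 \<union> V2) (E1 \<union> (E2 - {{u, v}})) l u v)"
proof -
  let ?f = "\<lambda>(q1, q2) x. if x \<in> V1 then q1 x else q2 x"
  let ?g = "\<lambda>q. (\<lambda>x. if x \<in> V1 then q x else (0, 0), \<lambda>x. if x \<in> V2 then q x else (0, 0))"
  let ?S = "SIGMA q1:pinned V1 E1 l u v. pinned V2 E2 (l({u, v} := snd (q1 v))) u v"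
  let ?P = "pinned (V1 \<union> V2) (E1 \<union> (E2 - {{u, v}})) l u v"
  have uv: "u \<in> V1" "v \<in> V1" "u \<in> V2" "v \<in> V2" using V by auto
  have agree: "?f (q1, q2) x = q2 x" if S: "(q1, q2) \<in> ?S" and x: "x \<in> V2" for q1 q2 x
  proof (cases "x \<in> V1")
    case True
    have q: "q1 \<in> pinned V1 E1 l u v" "q2 \<in> pinned V2 E2 (l({u, v} := snd (q1 v))) u v"
      using S by auto
    have "idist q2 u v = snd (q1 v)" using q(2) e by (simp add: pinned_def realises_def)
    then have "snd (q2 v) = snd (q1 v)" using pinned_idist[OF q(2)] by simp
    moreover have "x = u \<or> x = v" using True x V by auto
    ultimately have "q1 x = q2 x" using q by (auto simp: pinned_def prod_eq_iff)
    then show ?thesis by simp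
  qed simp
  show ?thesis
  proof (rule bij_betw_byWitness[where f' = ?g])
    show "\<forall>s\<in>?S. ?g (?f s) = s"
    proof
      fix s assume s: "s \<in> ?S"
      obtain q1 q2 where q: "s = (q1, q2)" by (cases s)
      have "q1 x = (0, 0)" if "x \<notin> V1" for x using s q that by (simp add: pinned_def)
      moreover have "q2 x = (0, 0)" if "x \<notin> V2" for x using s q that by (simp add: pinned_def)
      ultimately show "?g (?f s) = s" using agree[of q1 q2] s q by (auto simp: fun_eq_iff)
    qed
    show "\<forall>q\<in>?P. ?f (?g q) = q"
      by (auto simp: pinned_def fun_eq_iff)
    show "?f ` ?S \<subseteq> ?P"
    proof
      fix q assume "q \<in> ?f ` ?S"
      then obtain q1 q2 where S: "(q1, q2) \<in> ?S" and q: "q = ?f (q1, q2)" by auto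
      have q1: "q1 \<in> pinned V1 E1 l u v" and q2: "q2 \<in> pinned V2 E2 (l({u, v} := snd (q1 v))) u v"
        using S by auto
      have e1: "q x = q1 x" if "x \<in> V1" for x using that q by simp
      have e2: "q x = q2 x" if "x \<in> V2" for x using agree[OF S that] q by simp
      have "realises E1 l q"
        using q1 realises_cong[OF G1, of q q1] by (simp add: pinned_def idist_def e1)
      moreover have "realises E2 (l({u, v} := snd (q1 v))) q"
        using q2 realises_cong[OF G2, of q q2] by (simp add: pinned_def idist_def e2)
      moreover have "idist q u v = snd (q1 v)"
        using pinned_idist[OF q1] uv by (simp add: idist_def e1)
      ultimately have "realises (E1 \<union> (E2 - {{u, v}})) l q" by (simp add: realises_glue)
      moreover have "q u = (0, 0)" "fst (q v) = 1" using q1 uv by (simp_all add: e1 pinned_def)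
      moreover have "q x = (0, 0)" if "x \<notin> V1 \<union> V2" for x using q q2 that by (simp add: pinned_def)
      ultimately show "q \<in> ?P" by (simp add: pinned_def)
    qed
    show "?g ` ?P \<subseteq> ?S"
    proof
      fix s assume "s \<in> ?g ` ?P"
      then obtain q where q: "q \<in> ?P" and s: "s = ?g q" by auto
      have "realises E1 l q" "realises E2 (l({u, v} := idist q u v)) q"
        using q by (simp_all add: pinned_def realises_glue)
      then have "realises E1 l (fst s)" "realises E2 (l({u, v} := snd (q v))) (snd s)"
        using realises_cong[OF G1, of q "fst s"] realises_cong[OF G2, of q "snd s"] pinned_idist[OF q]
        by (simp_all add: s idist_def)
      then show "s \<in> ?S" using q uv by (simp add: s pinned_def)
    qed
  qed
qed

lemma K3_realisable:
  assumes abc: "a \<noteq> b" "b \<noteq> c" "a \<noteq> c" and "l {a, b} \<noteq> 0"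
  shows "\<exists>q. realises {{a, b}, {b, c}, {a, c}} l q"
proof -
  define d \<alpha> \<beta> where "d = l {a, b}" and "\<alpha> = l {a, c}" and "\<beta> = l {b, c}"
  define s where "s = \<alpha> + d - \<beta>"
  define W where "W = (s + csqrt (s\<^sup>2 - 4 * \<alpha> * d)) / 2"
  define Z where "Z = (s - W) / d"
  have d: "d \<noteq> 0" using assms by (simp add: d_def)
  have "(csqrt (s\<^sup>2 - 4 * \<alpha> * d))\<^sup>2 = s\<^sup>2 - 4 * \<alpha> * d" by simp
  moreover have "csqrt (s\<^sup>2 - 4 * \<alpha> * d) = 2 * W - s" by (simp add: W_def field_simps)
  ultimately have "(2 * W - s)\<^sup>2 = s\<^sup>2 - 4 * \<alpha> * d" by simp
  then have "4 * ((s - W) * W) = 4 * (\<alpha> * d)" by (simp add: power2_eq_square algebra_simps)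
  then have W: "(s - W) * W = \<alpha> * d" by simp
  have Zd: "Z * d = s - W" using d by (simp add: Z_def)
  have "(Z * W) * d = \<alpha> * d" using W Zd by (metis mult.assoc mult.commute)
  then have ZW: "Z * W = \<alpha>" using d by simp
  have ZW': "(1 - Z) * (d - W) = \<beta>" using ZW Zd by (simp add: algebra_simps s_def)
  define q where "q x = (if x = a then (0, 0) else if x = b then (1, d) else (Z, W))" for x
  have q: "q a = (0, 0)" "q b = (1, d)" "q c = (Z, W)" using abc by (auto simp: q_def)
  have D: "idist q a b = l {a, b}" "idist q a c = l {a, c}" "idist q b c = l {b, c}"
    using ZW ZW' by (simp_all add: idist_def q d_def \<alpha>_def \<beta>_def)
  have "realises {{a, b}, {b, c}, {a, c}} l q"
    unfolding realises_def
  proof (intro allI impI)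
    fix x y assume "{x, y} \<in> {{a, b}, {b, c}, {a, c}}"
    then consider "{x, y} = {a, b}" | "{x, y} = {b, c}" | "{x, y} = {a, c}" by blast
    then show "idist q x y = l {x, y}"
      using D idist_commute[of q a b] idist_commute[of q a c] idist_commute[of q b c]
      by cases (auto simp: doubleton_eq_iff insert_commute)
  qed
  then show ?thesis by blast
qed

text \<open>The induction runs over arbitrary independent lengths, because the second part is
  realised with a length of \<open>{u, v}\<close> taken from the first. These lengths are again
  independent, so the number of pinned second parts is the same for each pinned first part.\<close>

lemma card_dist_classes:
  assumes "Q_graph V E" "diff_indep E l"
  shows "card (dist_classes V E l) = 2 ^ (card V - 3)"
  using assms
proof (induction arbitrary: l rule: Q_graph.induct)
  case (K3 a b c)
  let ?E = "{{a, b}, {b, c}, {a, c}}"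
  have "l {a, b} \<notin> diff_closure {}"
    by (rule diff_indep_not_in_closure[OF K3.prems]) simp
  then have "l {a, b} \<noteq> 0" using diff_closure_0[of "{}"] by metis
  then obtain q where q: "realises ?E l q" using K3_realisable[OF K3.hyps] by metis
  have uniq: "dist_matrix {a, b, c} r = dist_matrix {a, b, c} q" if r: "realises ?E l r" for r
    unfolding dist_matrix_eq_iff
  proof (intro ballI)
    fix x y assume xy: "x \<in> {a, b, c}" "y \<in> {a, b, c}"
    show "idist r x y = idist q x y"
    proof (cases "x = y")
      case False
      then have e: "{x, y} \<in> ?E" using xy by (auto simp: doubleton_eq_iff)
      have "idist r x y = l {x, y}" using r e by (simp only: realises_def)
      moreover have "idist q x y = l {x, y}" using q e by (simp only: realises_def)
      ultimately show ?thesis by simp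
    qed simp
  qed
  have "M = dist_matrix {a, b, c} q" if "M \<in> dist_classes {a, b, c} ?E l" for M
    using that unfolding dist_classes_def
  proof (rule imageE)
    fix r assume "M = dist_matrix {a, b, c} r" "r \<in> {q. realises ?E l q}"
    then show ?thesis using uniq[of r] by (simp only: mem_Collect_eq)
  qed
  moreover have "dist_matrix {a, b, c} q \<in> dist_classes {a, b, c} ?E l"
    unfolding dist_classes_def using q by (intro imageI CollectI)
  ultimately have "dist_classes {a, b, c} ?E l = {dist_matrix {a, b, c} q}"
    by blast
  moreover have "card {a, b, c} = 3" using K3.hyps by simp
  ultimately show ?case by simp
next
  case (glue V1 E1 V2 E2 u v)
  let ?V = "V1 \<union> V2" and ?E = "E1 \<union> (E2 - {{u, v}})"
  have G: "Q_graph ?V ?E" by (rule Q_graph.glue[OF glue.hyps])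
  have uv: "u \<in> V1" "v \<in> V1" "u \<in> V2" "v \<in> V2" "u \<noteq> v" using glue.hyps by auto
  have ind1: "diff_indep E1 l" using glue.prems by (rule diff_indep_subset) auto
  define k1 k2 where "k1 = card V1 - 3" and "k2 = card V2 - 3"
  have c1: "card (pinned V1 E1 l u v) = 2 * 2 ^ k1"
    using card_pinned[OF glue.hyps(1) ind1 uv(1,2,5)] glue.IH(1)[OF ind1] by (simp add: k1_def)
  have c2: "card (pinned V2 E2 (l({u, v} := snd (q1 v))) u v) = 2 * 2 ^ k2"
    if q1: "q1 \<in> pinned V1 E1 l u v" for q1
  proof -
    have real: "realises E1 l q1" using q1 by (simp add: pinned_def)
    have "idist q1 u v \<in> diff_closure (l ` E1)"
      by (rule Q_graph_distances_in_closure[OF glue.hyps(1) real _ uv(1,2)])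
        (rule idist_nonzero[OF glue.hyps(1) ind1 real])
    moreover have "idist q1 u v \<notin> diff_closure {}"
      by (rule idist_transcendental[OF glue.hyps(1) ind1 real uv(1,2,5)])
    ultimately have ind2: "diff_indep E2 (l({u, v} := snd (q1 v)))"
      using diff_indep_glue[OF glue.prems Q_graph_edge_disjoint[OF glue.hyps(1-3)]]
      by (simp add: pinned_idist[OF q1])
    then show ?thesis
      using card_pinned[OF glue.hyps(2) ind2 uv(3,4,5)] glue.IH(2)[OF ind2] by (simp add: k2_def)
  qed
  have "card (pinned ?V ?E l u v) =
      card (SIGMA q1:pinned V1 E1 l u v. pinned V2 E2 (l({u, v} := snd (q1 v))) u v)"
    using bij_betw_same_card[OF pinned_glue_bij[OF glue.hyps(1-3,5)]] by simp
  also have "\<dots> = (\<Sum>q1\<in>pinned V1 E1 l u v. card (pinned V2 E2 (l({u, v} := snd (q1 v))) u v))"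
  proof (rule card_SigmaI)
    show "finite (pinned V1 E1 l u v)" by (rule card_ge_0_finite) (simp add: c1)
    show "\<forall>q1\<in>pinned V1 E1 l u v. finite (pinned V2 E2 (l({u, v} := snd (q1 v))) u v)"
      by (intro ballI card_ge_0_finite) (simp add: c2)
  qed
  also have "\<dots> = (2 * 2 ^ k1) * (2 * 2 ^ k2)" using c1 c2 by simp
  finally have "2 * card (dist_classes ?V ?E l) = (2 * 2 ^ k1) * (2 * 2 ^ k2)"
    using card_pinned[OF G glue.prems, of u v] uv by simp
  then have "card (dist_classes ?V ?E l) = 2 ^ (k1 + k2 + 1)" by (simp add: power_add)
  moreover have "card ?V + 2 = card V1 + card V2"
    using card_Un_Int[of V1 V2] glue.hyps Q_graph_finite[OF glue.hyps(1)] Q_graph_finite[OF glue.hyps(2)]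
    by simp
  \<comment> \<open>The extra 1 compensates for sharing only two vertices while each part subtracts
    3. Both parts have at least three vertices, so no subtraction is truncated.\<close>
  then have "k1 + k2 + 1 = card ?V - 3"
    using Q_graph_card[OF glue.hyps(1)] Q_graph_card[OF glue.hyps(2)]
    unfolding k1_def k2_def by arith
  ultimately show ?case by (simp only:)
qed

section \<open>From distance matrices back to congruence classes\<close>

lemma card_quotient_kernel: "card (A // {(q, r). f q = f r}) = card (f ` A)"
proof -
  \<comment> \<open>The relation lives on the whole type, so each class is a full fibre of
    \<open>f\<close> rather than its part in \<open>A\<close>; it still corresponds to one value of
    \<open>f\<close> on \<open>A\<close>.\<close>
  have "{(q, r). f q = f r} `` {x} = {r. f x = f r}" for x by blast
  then have "A // {(q, r). f q = f r} = (\<lambda>c. {r. c = f r}) ` f ` A"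
    by (simp add: quotient_def UNION_singleton_eq_range image_image)
  moreover have "inj_on (\<lambda>c. {r. c = f r}) (f ` A)"
  proof (rule inj_onI)
    fix c c' assume "c \<in> f ` A" and eq: "{r. c = f r} = {r. c' = f r}"
    then obtain x where "c = f x" by blast
    then have "x \<in> {r. c' = f r}" using eq[symmetric] by simp
    then show "c = c'" using \<open>c = f x\<close> by simp
  qed
  ultimately show ?thesis by (simp add: card_image)
qed

lemma isotropic_surj: "\<exists>q. isotropic \<circ> q = r"
proof
  have "2 * \<i> * (a / (2 * \<i>)) = a" for a by simp
  then have "\<i> * (a / (2 * \<i>)) = a / 2" for a by simp
  then show "isotropic \<circ> (\<lambda>x. ((fst (r x) + snd (r x)) / 2, (fst (r x) - snd (r x)) / (2 * \<i>))) = r"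
    by (simp add: isotropic_def fun_eq_iff prod_eq_iff flip: add_divide_distrib diff_divide_distrib)
qed

theorem theorem9p1:
  fixes V :: "'a set" and E :: "'a set set" and p :: "'a \<Rightarrow> complex \<times> complex"
  assumes "Q_graph V E"
    and "generic_real V p"
  shows "num_classes V E p = 2 ^ (card V - 3)"
proof -
  \<comment> \<open>Lengths are indexed by edges as unordered pairs; symmetry of \<open>sqd\<close>
    makes the description unique.\<close>
  define l where "l e = (THE d. \<exists>x y. e = {x, y} \<and> d = sqd p x y)" for e
  have l: "l {x, y} = sqd p x y" for x y
    unfolding l_def
    by (rule the_equality) (auto simp: doubleton_eq_iff sqd_eq_idist idist_commute[of _ x y])
  have eq: "equivalent_real E p q \<longleftrightarrow> realises E l (isotropic \<circ> q)" for q
    unfolding equivalent_real_def realises_def l sqd_eq_idist[of q, symmetric] by metis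
  let ?f = "\<lambda>q. dist_matrix V (isotropic \<circ> q)"
  have "congruent_real V q r \<longleftrightarrow> ?f q = ?f r" for q r
    by (simp add: congruent_real_def sqd_eq_idist dist_matrix_eq_iff)
  then have "num_classes V E p = card (?f ` {q. equivalent_real E p q})"
    using card_quotient_kernel[of "{q. equivalent_real E p q}" ?f] by (simp add: num_classes_def)
  also have "?f ` {q. equivalent_real E p q} = dist_classes V E l"
  proof
    show "?f ` {q. equivalent_real E p q} \<subseteq> dist_classes V E l"
      by (auto simp: eq dist_classes_def)
    show "dist_classes V E l \<subseteq> ?f ` {q. equivalent_real E p q}"
    proof
      fix M assume "M \<in> dist_classes V E l"
      then obtain r where r: "realises E l r" "M = dist_matrix V r" by (auto simp: dist_classes_def)
      obtain q where "isotropic \<circ> q = r" using isotropic_surj by blast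
      then show "M \<in> ?f ` {q. equivalent_real E p q}" using r eq by auto
    qed
  qed
  also have "card (dist_classes V E l) = 2 ^ (card V - 3)"
  proof (rule card_dist_classes[OF assms(1) generic_lengths_indep[OF assms]])
    show "realises E l (isotropic \<circ> p)" using eq[of p] by (simp add: equivalent_real_def)
  qed
  finally show ?thesis .
qed

end
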